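(* Let $\Gamma$ be an LR-tableau with entries at most $2$, and let $(\alpha,\beta,\gamma)$ be partitions with $\alpha_1\le2$. (1) The poset $(\mathcal K(\Gamma),\leq_{\rm arc})$ has exactly one minimal element, namely the dominant Klein tableau refining $\Gamma$. (2) The poset $(\mathcal K(\Gamma),\leq_{\rm arc})$ has exactly one maximal element. (3) The poset $(\mathcal K(\alpha,\beta,\gamma),\leq_{\rm arc})$ has exactly one maximal element. (4) The set of minimal elements of $(\mathcal K(\alpha,\beta,\gamma),\leq_{\rm arc})$ consists of the minimal elements of the posets $\mathcal K(\Gamma_1),\ldots,\mathcal K(\Gamma_s)$, where $\Gamma_1,\ldots,\Gamma_s$ are all the LR-tableaux of type $(\alpha,\beta,\gamma)$.
   Context: Young diagram conventions: a partition $\lambda$ has columns of lengths $\lambda_1,\lambda_2,\ldots$, rows numbered from the top; $\bar\lambda$ is the conjugate partition. An LR-tableau of type $(\alpha,\beta,\gamma)$ with entries at most $2$ is a filling of the skew diagram $\beta\setminus\gamma$ with $\bar\alpha_1$ entries $1$ and $\bar\alpha_2$ entries $2$, weakly increasing along rows, strictly increasing down columns, such that for each $c\ge0$ the number of $2$'s in columns to the right of column $c$ is at most the number of $1$'s there. A Klein tableau is such a tableau where each entry $2$ carries a subscript $r$ ($2_r$) with: (a) $1\le r\le m-1$ if it lies in row $m$; (b) $r=m-1$ if the box above it contains $1$; (c) the number of $2_r$'s is at most the number of $1$'s in row $r$. It refines the LR-tableau obtained by removing subscripts. The dominant Klein tableau refining $\Gamma$ is obtained by going through the entries $2$ of $\Gamma$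 row by row from the top and assigning to each the largest available subscript. $\mathcal K(\Gamma)$ is the set of Klein tableaux refining $\Gamma$ and $\mathcal K(\alpha,\beta,\gamma)$ the set of all Klein tableaux of type $(\alpha,\beta,\gamma)$. Arc diagram of a Klein tableau: an arc $(m,r)$ for each $2_r$ in row $m$, and at each position $r$ as many poles as the number of $1$'s in row $r$ minus the number of arcs ending at $r$; a Klein tableau of given type is determined by its arc diagram. Moves: for $m>n>r>s$, (A) replaces arcs $(m,r),(n,s)$ by $(m,s),(n,r)$; (C) replaces arcs $(m,r),(n,s)$ by $(m,n),(r,s)$; for $m>r>s$, (B) replaces arc $(m,s)$ and pole at $r$ by arc $(m,r)$ and pole at $s$; (D) replaces arc $(m,s)$ and pole at $r$ by pole at $m$ and arc $(r,s)$. For Klein tableaux $\Pi,\Pi'$ of the same type, $\Pi\leq_{\rm arc}\Pi'$ if the arc diagram of $\Pi$ is obtained from that of $\Pi'$ by a finite (possibly empty) sequence of moves; this is a partial order.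
   Formalization: Part (3) is stated for triples (α,β,γ) for which an LR-tableau of that type exists, since otherwise K(α,β,γ) is empty and has no maximal element; subscripts of the 2's are taken weakly increasing within each row, so that a Klein tableau is determined by its arc diagram. *)

theory Defs
  imports Main "HOL-Library.Multiset"
begin

text \<open>A partition is a weakly decreasing list of positive naturals; the entries are
  the column lengths lambda_1, lambda_2, ... . Columns and rows are numbered from 1.\<close>

definition is_partition :: "nat list \<Rightarrow> bool" where
  "is_partition l \<longleftrightarrow> sorted_wrt (\<ge>) l \<and> (\<forall>x\<in>set l. 0 < x)"

definition col :: "nat list \<Rightarrow> nat \<Rightarrow> nat" where
  "col l j = (if 1 \<le> j \<and> j \<le> length l then l ! (j - 1) else 0)"

definition conj :: "nat list \<Rightarrow> nat \<Rightarrow> nat" where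
  "conj l k = length (filter (\<lambda>x. k \<le> x) l)"

definition part_le :: "nat list \<Rightarrow> nat list \<Rightarrow> bool" where
  "part_le g b \<longleftrightarrow> (\<forall>j. col g j \<le> col b j)"

definition skew :: "nat list \<Rightarrow> nat list \<Rightarrow> (nat \<times> nat) set" where
  "skew b g = {(i, j). col g j < i \<and> i \<le> col b j}"

definition lr_tableau :: "nat list \<Rightarrow> nat list \<Rightarrow> nat list \<Rightarrow> (nat \<Rightarrow> nat \<Rightarrow> nat) \<Rightarrow> bool" where
  "lr_tableau a b g T \<longleftrightarrow>
     (\<forall>i j. (i, j) \<notin> skew b g \<longrightarrow> T i j = 0) \<and>
     (\<forall>i j. (i, j) \<in> skew b g \<longrightarrow> T i j = 1 \<or> T i j = 2) \<and>
     card {(i, j). (i, j) \<in> skew b g \<and> T i j = 1} = conj a 1 \<and>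
     card {(i, j). (i, j) \<in> skew b g \<and> T i j = 2} = conj a 2 \<and>
     (\<forall>i j j'. (i, j) \<in> skew b g \<longrightarrow> (i, j') \<in> skew b g \<longrightarrow> j < j' \<longrightarrow> T i j \<le> T i j') \<and>
     (\<forall>i i' j. (i, j) \<in> skew b g \<longrightarrow> (i', j) \<in> skew b g \<longrightarrow> i < i' \<longrightarrow> T i j < T i' j) \<and>
     (\<forall>c. card {(i, j). (i, j) \<in> skew b g \<and> c < j \<and> T i j = 2}
          \<le> card {(i, j). (i, j) \<in> skew b g \<and> c < j \<and> T i j = 1})"

text \<open>KE = empty box (outside the diagram), K1 = entry 1, K2 r = entry 2 with subscript r.\<close>
datatype kentry = KE | K1 | K2 nat

definition forget :: "(nat \<Rightarrow> nat \<Rightarrow> kentry) \<Rightarrow> nat \<Rightarrow> nat \<Rightarrow> nat" where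
  "forget P i j = (case P i j of KE \<Rightarrow> 0 | K1 \<Rightarrow> 1 | K2 r \<Rightarrow> 2)"

definition klein :: "nat list \<Rightarrow> nat list \<Rightarrow> nat list \<Rightarrow> (nat \<Rightarrow> nat \<Rightarrow> kentry) \<Rightarrow> bool" where
  "klein a b g P \<longleftrightarrow>
     lr_tableau a b g (forget P) \<and>
     (\<forall>i j r. P i j = K2 r \<longrightarrow> 1 \<le> r \<and> r \<le> i - 1) \<and>
     (\<forall>i j r. P i j = K2 r \<longrightarrow> P (i - 1) j = K1 \<longrightarrow> r = i - 1) \<and>
     (\<forall>r. card {(i, j). (i, j) \<in> skew b g \<and> P i j = K2 r}
          \<le> card {(i, j). (i, j) \<in> skew b g \<and> i = r \<and> P i j = K1}) \<and>
     (\<forall>i j j' r r'. P i j = K2 r \<longrightarrow> P i j' = K2 r' \<longrightarrow> j < j' \<longrightarrow> r \<le> r')"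

definition klein_all :: "nat list \<Rightarrow> nat list \<Rightarrow> nat list \<Rightarrow> (nat \<Rightarrow> nat \<Rightarrow> kentry) set" where
  "klein_all a b g = {P. klein a b g P}"

definition klein_ref :: "nat list \<Rightarrow> nat list \<Rightarrow> nat list \<Rightarrow> (nat \<Rightarrow> nat \<Rightarrow> nat) \<Rightarrow> (nat \<Rightarrow> nat \<Rightarrow> kentry) set" where
  "klein_ref a b g T = {P. klein a b g P \<and> forget P = T}"

definition subscr :: "kentry \<Rightarrow> nat" where
  "subscr e = (case e of K2 r \<Rightarrow> r | _ \<Rightarrow> 0)"

definition is_two :: "kentry \<Rightarrow> bool" where
  "is_two e = (case e of K2 r \<Rightarrow> True | _ \<Rightarrow> False)"

definition arcs :: "nat list \<Rightarrow> nat list \<Rightarrow> (nat \<Rightarrow> nat \<Rightarrow> kentry) \<Rightarrow> (nat \<times> nat) multiset" where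
  "arcs b g P = image_mset (\<lambda>(i, j). (i, subscr (P i j)))
      (mset_set {(i, j). (i, j) \<in> skew b g \<and> is_two (P i j)})"

definition poles :: "nat list \<Rightarrow> nat list \<Rightarrow> (nat \<Rightarrow> nat \<Rightarrow> kentry) \<Rightarrow> nat multiset" where
  "poles b g P = image_mset fst (mset_set {(i, j). (i, j) \<in> skew b g \<and> P i j = K1})
                 - image_mset snd (arcs b g P)"

definition arc_diagram :: "nat list \<Rightarrow> nat list \<Rightarrow> (nat \<Rightarrow> nat \<Rightarrow> kentry) \<Rightarrow> (nat \<times> nat) multiset \<times> nat multiset" where
  "arc_diagram b g P = (arcs b g P, poles b g P)"

definition arc_move :: "(nat \<times> nat) multiset \<times> nat multiset \<Rightarrow> (nat \<times> nat) multiset \<times> nat multiset \<Rightarrow> bool" where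
  "arc_move D D' \<longleftrightarrow> (let A = fst D; Q = snd D; A' = fst D'; Q' = snd D' in
     (\<exists>m n r s. s < r \<and> r < n \<and> n < m \<and> {#(m, r), (n, s)#} \<subseteq># A \<and> Q' = Q \<and>
        (A' = A - {#(m, r), (n, s)#} + {#(m, s), (n, r)#} \<comment> \<open>(A)\<close>
         \<or> A' = A - {#(m, r), (n, s)#} + {#(m, n), (r, s)#})) \<comment> \<open>(C)\<close>
   \<or> (\<exists>m r s. s < r \<and> r < m \<and> (m, s) \<in># A \<and> r \<in># Q \<and>
        ((A' = A - {#(m, s)#} + {#(m, r)#} \<and> Q' = Q - {#r#} + {#s#}) \<comment> \<open>(B)\<close>
         \<or> (A' = A - {#(m, s)#} + {#(r, s)#} \<and> Q' = Q - {#r#} + {#m#}))))"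

definition arc_le :: "nat list \<Rightarrow> nat list \<Rightarrow> nat list \<Rightarrow> (nat \<Rightarrow> nat \<Rightarrow> kentry) \<Rightarrow> (nat \<Rightarrow> nat \<Rightarrow> kentry) \<Rightarrow> bool" where
  "arc_le a b g P P' \<longleftrightarrow> klein a b g P \<and> klein a b g P' \<and>
     arc_move\<^sup>*\<^sup>* (arc_diagram b g P') (arc_diagram b g P)"

definition minimal_in :: "nat list \<Rightarrow> nat list \<Rightarrow> nat list \<Rightarrow> (nat \<Rightarrow> nat \<Rightarrow> kentry) set \<Rightarrow> (nat \<Rightarrow> nat \<Rightarrow> kentry) \<Rightarrow> bool" where
  "minimal_in a b g S P \<longleftrightarrow> P \<in> S \<and> (\<forall>P'\<in>S. arc_le a b g P' P \<longrightarrow> P' = P)"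

definition maximal_in :: "nat list \<Rightarrow> nat list \<Rightarrow> nat list \<Rightarrow> (nat \<Rightarrow> nat \<Rightarrow> kentry) set \<Rightarrow> (nat \<Rightarrow> nat \<Rightarrow> kentry) \<Rightarrow> bool" where
  "maximal_in a b g S P \<longleftrightarrow> P \<in> S \<and> (\<forall>P'\<in>S. arc_le a b g P P' \<longrightarrow> P' = P)"

definition ones_in_row :: "nat list \<Rightarrow> nat list \<Rightarrow> (nat \<Rightarrow> nat \<Rightarrow> nat) \<Rightarrow> nat \<Rightarrow> nat" where
  "ones_in_row b g T r = card {j. (r, j) \<in> skew b g \<and> T r j = 1}"

text \<open>Subscript r is available for the 2 at (i, j), given that cnt r subscripts r
  have already been assigned: conditions (a), (b), (c).\<close>
definition dom_avail :: "nat list \<Rightarrow> nat list \<Rightarrow> (nat \<Rightarrow> nat \<Rightarrow> nat) \<Rightarrow> (nat \<Rightarrow> nat) \<Rightarrow> nat \<Rightarrow> nat \<Rightarrow> nat \<Rightarrow> bool" where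
  "dom_avail b g T cnt i j r \<longleftrightarrow> 1 \<le> r \<and> r \<le> i - 1 \<and> (T (i - 1) j = 1 \<longrightarrow> r = i - 1)
      \<and> cnt r < ones_in_row b g T r"

definition dom_step :: "nat list \<Rightarrow> nat list \<Rightarrow> (nat \<Rightarrow> nat \<Rightarrow> nat) \<Rightarrow> nat \<times> nat
     \<Rightarrow> (nat \<times> nat \<Rightarrow> nat) \<times> (nat \<Rightarrow> nat) \<Rightarrow> (nat \<times> nat \<Rightarrow> nat) \<times> (nat \<Rightarrow> nat)" where
  "dom_step b g T x st =
     (let i = fst x; j = snd x; cnt = snd st;
          r = (if \<exists>r. dom_avail b g T cnt i j r then Max {r. dom_avail b g T cnt i j r} else 0)
      in ((fst st)(x := r), cnt(r := Suc (cnt r))))"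

definition dom_boxes :: "nat list \<Rightarrow> nat list \<Rightarrow> (nat \<Rightarrow> nat \<Rightarrow> nat) \<Rightarrow> (nat \<times> nat) list" where
  "dom_boxes b g T = filter (\<lambda>x. x \<in> skew b g \<and> T (fst x) (snd x) = 2)
      (concat (map (\<lambda>i. map (\<lambda>j. (i, j)) (rev [1..<Suc (length b)])) [1..<Suc (col b 1)]))"

definition dominant :: "nat list \<Rightarrow> nat list \<Rightarrow> (nat \<Rightarrow> nat \<Rightarrow> nat) \<Rightarrow> nat \<Rightarrow> nat \<Rightarrow> kentry" where
  "dominant b g T = (let sg = fst (fold (dom_step b g T) (dom_boxes b g T) (\<lambda>_. 0, \<lambda>_. 0))
     in (\<lambda>i j. if (i, j) \<in> skew b g then (if T i j = 1 then K1 else K2 (sg (i, j))) else KE))"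

end

theory Submission
  imports Defs
begin

text \<open>
  Arc diagrams of Klein tableaux of a given type are exactly the diagrams in which every row \<open>i\<close> has a
  prescribed degree (arc ends plus poles), the number of arcs is prescribed, and at least as many
  arcs \<open>(i + 1, i)\<close> occur as there are columns with boxes in rows \<open>i\<close> and \<open>i + 1\<close>. A move never destroys
  an arc \<open>(i + 1, i)\<close>, so these diagrams are closed under moves, and a linear weight on diagrams
  strictly decreases along moves; hence extremal elements exist.

  Minimal elements of \<open>K(\<Gamma>)\<close>: moves (A) and (B) preserve \<open>\<Gamma>\<close>, so a minimal element has no crossing
  arcs and no pole under an arc. Then no move at all applies to it, which makes it minimal among all
  Klein tableaux of its type, and the greedy choice of largest subscripts reproduces it.

  Maximal elements: given two different tableaux in \<open>K(\<Gamma>)\<close>, at the first place where they differ one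
  of them admits an inverse move (A) or (B). Given two Klein tableaux of the same type with different
  underlying LR-tableaux, at the last row with different numbers of 2's the one with fewer 2's
  admits an inverse move (C) or (D).
\<close>

section \<open>Row form of LR-tableaux and Klein tableaux\<close>

text \<open>Moves act on diagrams while the posets consist of fillings, so a diagram reached by a
  move has to come from a tableau again. The conditions in \<open>valid\<close> reduce this to
  bookkeeping. The lattice condition is not among them, since each arc already matches a 2 with a 1
  in a higher row, and weak increase of entries and subscripts along rows leaves one filling per
  diagram. The LR-tableau \<Gamma> is visible in the diagram as the multiset of arc starts. (A) and
  (C) apply to the same pairs of arcs, (B) and (D) to the same arc and pole; hence excluding (A) and
  (B) excludes all four. Every arc removed by a move spans more than one row, so going down costs
  nothing. An inverse move may remove a forced arc (i + 1, i). This is why maximality is treated by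
  comparing two tableaux: the second one, which satisfies the same forced counts, certifies that the
  arc to be removed from the first is in excess.\<close>

lemma le_col_iff:
  assumes "is_partition l" "1 \<le> i"
  shows "i \<le> col l j \<longleftrightarrow> 1 \<le> j \<and> j \<le> conj l i"
  using assms(1)
proof (induction l arbitrary: j)
  case Nil
  then show ?case using assms(2) by (auto simp: col_def conj_def)
next
  case (Cons x l)
  have p: "is_partition l" and le: "\<forall>y\<in>set l. y \<le> x"
    using Cons.prems by (auto simp: is_partition_def)
  have none: "conj l i = 0" if "x < i"
    using le that by (force simp: conj_def filter_empty_conv)
  show ?case
  proof (cases j)
    case 0
    then show ?thesis using assms(2) by (simp add: col_def)
  next
    case (Suc j')
    have c: "col (x # l) j = (if j' = 0 then x else col l j')"
      using Suc by (auto simp: col_def nth_Cons')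
    show ?thesis
    proof (cases "j' = 0")
      case True
      then show ?thesis using Suc c none by (auto simp: conj_def)
    next
      case False
      then show ?thesis using Suc c none Cons.IH[OF p, of j'] by (auto simp: conj_def)
    qed
  qed
qed

text \<open>The columns of length at least \<open>i\<close> come before the shorter ones, so each
  row of a skew diagram is an interval of columns. Questions about neighbouring rows thereby become
  linear arithmetic.\<close>

lemma skew_iff:
  assumes "is_partition b" "is_partition g"
  shows "(i, j) \<in> skew b g \<longleftrightarrow> 1 \<le> i \<and> conj g i < j \<and> j \<le> conj b i"
proof (cases "1 \<le> i")
  case True
  have "col g j < i \<longleftrightarrow> \<not> (1 \<le> j \<and> j \<le> conj g i)"
    using le_col_iff[OF assms(2) True, of j] by auto
  then show ?thesis
    using le_col_iff[OF assms(1) True, of j] True by (auto simp: skew_def)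
qed (auto simp: skew_def)

lemma conj_antimono: "i \<le> i' \<Longrightarrow> conj l i' \<le> conj l i"
  by (induction l) (auto simp: conj_def)

text \<open>The row bound \<open>sum_list b\<close> is crude but holds for every list
  \<open>b\<close>. It later bounds the arc starts in the potential and the rows in which arcs have
  to be built.\<close>

lemma skew_bounds:
  assumes "(i, j) \<in> skew b g"
  shows "1 \<le> i" "i \<le> sum_list b" "1 \<le> j" "j \<le> length b"
proof -
  have *: "col g j < i" "i \<le> col b j"
    using assms by (auto simp: skew_def)
  then have j: "1 \<le> j \<and> j \<le> length b"
    by (auto simp: col_def split: if_splits)
  then have "col b j \<in> set b"
    by (auto simp: col_def)
  then show "i \<le> sum_list b"
    using *(2) member_le_sum_list[of "col b j" b] by simp
  show "1 \<le> i" "1 \<le> j" "j \<le> length b" using * j by auto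
qed

lemma finite_skew: "finite (skew b g)"
proof (rule finite_subset)
  show "skew b g \<subseteq> {..sum_list b} \<times> {..length b}"
    using skew_bounds by fastforce
qed simp

lemma finite_skew_Collect [simp]: "finite {(i, j). (i, j) \<in> skew b g \<and> R i j}"
  by (rule finite_subset[OF _ finite_skew[of b g]]) auto

lemma finite_skew_row [simp]: "finite {j. (i, j) \<in> skew b g \<and> R j}"
  by (rule finite_subset[of _ "{..length b}"]) (use skew_bounds in blast | simp)+

section \<open>Counting the arcs of a filling by row, by subscript and in total\<close>

lemma count_image_mset_set:
  assumes "finite S"
  shows "count (image_mset f (mset_set S)) y = card {x \<in> S. f x = y}"
  using assms
proof (induction S rule: finite_induct)
  case (insert x S)
  have "{z \<in> insert x S. f z = y} = (if f x = y then insert x {z \<in> S. f z = y} else {z \<in> S. f z = y})"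
    by auto
  then show ?case using insert by simp
qed simp

lemma size_filter_eq_sum_count:
  assumes "finite S"
  shows "size (filter_mset (\<lambda>x. f x \<in> S) A) = (\<Sum>i\<in>S. count (image_mset f A) i)"
proof (induction A)
  case (add x A)
  have "(\<Sum>i\<in>S. count (image_mset f (add_mset x A)) i)
      = (\<Sum>i\<in>S. count (image_mset f A) i) + (\<Sum>i\<in>S. if f x = i then 1 else 0)"
    by (auto simp: sum.distrib[symmetric] intro!: sum.cong)
  then show ?case using add assms by simp
qed simp

lemma count_fst_eq_card:
  "count (image_mset fst (arcs b g P)) i = card {j. (i, j) \<in> skew b g \<and> forget P i j = 2}"
proof -
  have "image_mset fst (arcs b g P) = image_mset fst (mset_set {(i, j). (i, j) \<in> skew b g \<and> is_two (P i j)})"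
    unfolding arcs_def image_mset.compositionality by (rule image_mset_cong) auto
  then have "count (image_mset fst (arcs b g P)) i
      = card {x \<in> {(i, j). (i, j) \<in> skew b g \<and> is_two (P i j)}. fst x = i}"
    by (simp add: count_image_mset_set)
  also have "{x \<in> {(i, j). (i, j) \<in> skew b g \<and> is_two (P i j)}. fst x = i}
      = Pair i ` {j. (i, j) \<in> skew b g \<and> forget P i j = 2}"
    by (auto simp: is_two_def forget_def split: kentry.splits)
  finally show ?thesis
    by (simp add: card_image inj_on_def)
qed

lemma count_arcs_eq_card:
  "count (arcs b g P) (i, r) = card {j. (i, j) \<in> skew b g \<and> P i j = K2 r}"
proof -
  have "count (arcs b g P) (i, r) = card {x \<in> {(i, j). (i, j) \<in> skew b g \<and> is_two (P i j)}.
      (case x of (i, j) \<Rightarrow> (i, subscr (P i j))) = (i, r)}"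
    unfolding arcs_def by (simp add: count_image_mset_set)
  also have "{x \<in> {(i, j). (i, j) \<in> skew b g \<and> is_two (P i j)}.
      (case x of (i, j) \<Rightarrow> (i, subscr (P i j))) = (i, r)} = Pair i ` {j. (i, j) \<in> skew b g \<and> P i j = K2 r}"
    by (auto simp: is_two_def subscr_def split: kentry.splits)
  finally show ?thesis
    by (simp add: card_image inj_on_def)
qed

lemma count_snd_eq_card:
  "count (image_mset snd (arcs b g P)) r = card {(i, j). (i, j) \<in> skew b g \<and> P i j = K2 r}"
proof -
  have "count (image_mset snd (arcs b g P)) r
      = card {x \<in> {(i, j). (i, j) \<in> skew b g \<and> is_two (P i j)}. snd (case x of (i, j) \<Rightarrow> (i, subscr (P i j))) = r}"
    unfolding arcs_def image_mset.compositionality comp_def by (simp add: count_image_mset_set)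
  also have "{x \<in> {(i, j). (i, j) \<in> skew b g \<and> is_two (P i j)}. snd (case x of (i, j) \<Rightarrow> (i, subscr (P i j))) = r}
      = {(i, j). (i, j) \<in> skew b g \<and> P i j = K2 r}"
    by (auto simp: is_two_def subscr_def split: kentry.splits)
  finally show ?thesis .
qed

lemma size_arcs: "size (arcs b g P) = card {(i, j). (i, j) \<in> skew b g \<and> forget P i j = 2}"
proof -
  have "{(i, j). (i, j) \<in> skew b g \<and> is_two (P i j)} = {(i, j). (i, j) \<in> skew b g \<and> forget P i j = 2}"
    by (auto simp: is_two_def forget_def split: kentry.splits)
  then show ?thesis by (simp add: arcs_def)
qed

lemma count_fst_skew:
  "count (image_mset fst (mset_set {(i, j). (i, j) \<in> skew b g \<and> R i j})) r
     = card {j. (r, j) \<in> skew b g \<and> R r j}"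
proof -
  have "{x \<in> {(i, j). (i, j) \<in> skew b g \<and> R i j}. fst x = r} = Pair r ` {j. (r, j) \<in> skew b g \<and> R r j}"
    by auto
  then show ?thesis
    by (simp add: count_image_mset_set card_image inj_on_def)
qed

text \<open>\<open>x i\<close> is the number of boxes in row \<open>i\<close>, \<open>k i\<close> the number of columns with boxes in rows \<open>i\<close>
  and \<open>i + 1\<close>; condition (b) turns each of the latter into an arc \<open>(i + 1, i)\<close>.\<close>

definition valid :: "(nat \<Rightarrow> nat) \<Rightarrow> (nat \<Rightarrow> nat) \<Rightarrow> nat \<Rightarrow> (nat \<times> nat) multiset \<Rightarrow> nat multiset \<Rightarrow> bool" where
  "valid x k N A Q \<longleftrightarrow>
     (\<forall>m r. (m, r) \<in># A \<longrightarrow> 1 \<le> r \<and> r < m) \<and>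
     (\<forall>i. count (image_mset fst A) i + count (image_mset snd A) i + count Q i = x i) \<and>
     size A = N \<and>
     (\<forall>i. k i \<le> count A (Suc i, i))"

definition row_size :: "nat list \<Rightarrow> nat list \<Rightarrow> nat \<Rightarrow> nat" where
  "row_size b g i = card {j. (i, j) \<in> skew b g}"

definition overlap :: "nat list \<Rightarrow> nat list \<Rightarrow> nat \<Rightarrow> nat" where
  "overlap b g i = card {j. (i, j) \<in> skew b g \<and> (Suc i, j) \<in> skew b g}"

lemma row_size_eq:
  assumes "is_partition b" "is_partition g" "1 \<le> i"
  shows "row_size b g i = conj b i - conj g i"
proof -
  have "{j. (i, j) \<in> skew b g} = {conj g i<..conj b i}"
    using assms by (auto simp: skew_iff)
  then show ?thesis by (simp add: row_size_def)
qed

lemma row_size_0: "row_size b g 0 = 0"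
  by (simp add: row_size_def skew_def)

lemma skew_overlap_iff:
  assumes "is_partition b" "is_partition g"
  shows "(i, j) \<in> skew b g \<and> (Suc i, j) \<in> skew b g \<longleftrightarrow> 1 \<le> i \<and> conj g i < j \<and> j \<le> conj b (Suc i)"
  using conj_antimono[of i "Suc i" b] conj_antimono[of i "Suc i" g]
  unfolding skew_iff[OF assms] by linarith

lemma overlap_eq:
  assumes "is_partition b" "is_partition g" "1 \<le> i"
  shows "overlap b g i = conj b (Suc i) - conj g i"
proof -
  have "{j. (i, j) \<in> skew b g \<and> (Suc i, j) \<in> skew b g} = {conj g i<..conj b (Suc i)}"
    unfolding skew_overlap_iff[OF assms(1,2)] using assms(3) by auto
  then show ?thesis by (simp add: overlap_def)
qed

section \<open>Rows of an LR-tableau: the 2's are the rightmost boxes\<close>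

lemma up_closed_eq_interval:
  fixes S :: "nat set"
  assumes "S \<subseteq> {l<..u}" "\<And>i j. i \<in> S \<Longrightarrow> i < j \<Longrightarrow> j \<le> u \<Longrightarrow> j \<in> S"
  shows "S = {u - card S<..u}"
proof (cases "S = {}")
  case False
  have fin: "finite S" using assms(1) finite_subset by blast
  define m where "m = Min S"
  have m: "m \<in> S" using False fin by (simp add: m_def)
  have S: "S = {m..u}"
  proof
    show "S \<subseteq> {m..u}" using fin assms(1) by (auto simp: m_def)
    show "{m..u} \<subseteq> S"
    proof
      fix j assume "j \<in> {m..u}"
      then show "j \<in> S" using assms(2)[OF m, of j] m by (cases "j = m") auto
    qed
  qed
  \<comment> \<open>\<open>l < m\<close> makes \<open>m\<close> positive, so subtracting 1 to get
    the open left end does not truncate.\<close>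
  have "l < m" "m \<le> u" using m assms(1) by auto
  moreover have "card S = Suc u - m" using S by simp
  ultimately have "u - card S = m - 1" "1 \<le> m" by auto
  then show ?thesis using S by auto
qed simp

abbreviation twos :: "nat list \<Rightarrow> nat list \<Rightarrow> (nat \<Rightarrow> nat \<Rightarrow> nat) \<Rightarrow> nat \<Rightarrow> nat" where
  "twos b g T i \<equiv> card {j. (i, j) \<in> skew b g \<and> T i j = 2}"

lemma lr_tableau_values:
  assumes "lr_tableau a b g T" "(i, j) \<in> skew b g"
  shows "T i j = 1 \<or> T i j = 2"
  using assms unfolding lr_tableau_def by (elim conjE) blast

lemma lr_tableau_outside:
  assumes "lr_tableau a b g T" "(i, j) \<notin> skew b g"
  shows "T i j = 0"
  using assms unfolding lr_tableau_def by (elim conjE) blast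

lemma lr_tableau_row:
  assumes "lr_tableau a b g T" "(i, j) \<in> skew b g" "(i, j') \<in> skew b g" "j < j'"
  shows "T i j \<le> T i j'"
  using assms unfolding lr_tableau_def by (elim conjE) blast

lemma lr_tableau_col:
  assumes "lr_tableau a b g T" "(i, j) \<in> skew b g" "(i', j) \<in> skew b g" "i < i'"
  shows "T i j = 1" "T i' j = 2"
proof -
  have "T i j < T i' j"
    using assms unfolding lr_tableau_def by (elim conjE) blast
  then show "T i j = 1" "T i' j = 2"
    using lr_tableau_values[OF assms(1,2)] lr_tableau_values[OF assms(1,3)] by auto
qed

lemma lr_tableau_lattice:
  assumes "lr_tableau a b g T"
  shows "card {(i, j). (i, j) \<in> skew b g \<and> c < j \<and> T i j = 2}
          \<le> card {(i, j). (i, j) \<in> skew b g \<and> c < j \<and> T i j = 1}"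
  using assms unfolding lr_tableau_def by blast

lemma card_row_sum:
  assumes "finite I"
  shows "card {(i, j). (i, j) \<in> skew b g \<and> i \<in> I \<and> R i j} = (\<Sum>i\<in>I. card {j. (i, j) \<in> skew b g \<and> R i j})"
proof -
  have "{(i, j). (i, j) \<in> skew b g \<and> i \<in> I \<and> R i j} = (SIGMA i:I. {j. (i, j) \<in> skew b g \<and> R i j})"
    by auto
  then show ?thesis
    using assms by (simp add: card_SigmaI)
qed

lemma ones_plus_twos:
  assumes "lr_tableau a b g T"
  shows "ones_in_row b g T i + twos b g T i = row_size b g i"
proof -
  have "{j. (i, j) \<in> skew b g} = {j. (i, j) \<in> skew b g \<and> T i j = 1} \<union> {j. (i, j) \<in> skew b g \<and> T i j = 2}"
    using lr_tableau_values[OF assms] by auto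
  moreover have "{j. (i, j) \<in> skew b g \<and> T i j = 1} \<inter> {j. (i, j) \<in> skew b g \<and> T i j = 2} = {}"
    by auto
  ultimately show ?thesis
    by (simp add: row_size_def ones_in_row_def card_Un_disjoint)
qed

lemma lr_tableau_two_iff:
  assumes "is_partition b" "is_partition g" "lr_tableau a b g T" "(i, j) \<in> skew b g"
  shows "T i j = 2 \<longleftrightarrow> conj b i - twos b g T i < j"
proof -
  let ?S = "{j. (i, j) \<in> skew b g \<and> T i j = 2}"
  have i: "1 \<le> i" using assms(4) skew_bounds by blast
  have "?S = {conj b i - card ?S<..conj b i}"
  proof (rule up_closed_eq_interval)
    show "?S \<subseteq> {conj g i<..conj b i}"
      by (auto simp: skew_iff[OF assms(1,2)])
  next
    fix j j' assume j: "j \<in> ?S" "j < j'" "j' \<le> conj b i"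
    then have s: "(i, j') \<in> skew b g"
      using i by (auto simp: skew_iff[OF assms(1,2)])
    then have "T i j' = 2"
      using lr_tableau_row[OF assms(3) _ s j(2)] lr_tableau_values[OF assms(3) s] j(1) by auto
    then show "j' \<in> ?S" using s by simp
  qed
  then have "j \<in> ?S \<longleftrightarrow> j \<in> {conj b i - card ?S<..conj b i}"
    by (rule arg_cong)
  moreover have "j \<le> conj b i" using assms(4) by (simp add: skew_iff[OF assms(1,2)])
  ultimately show ?thesis using assms(4) by simp
qed

text \<open>In each row the 2's occupy the rightmost boxes, so their number fixes the row. Through
  this the multiset of arc starts can stand for the LR-tableau.\<close>

lemma lr_tableau_eqI:
  assumes "is_partition b" "is_partition g" "lr_tableau a b g T" "lr_tableau a b g T'"
    and "\<And>i. twos b g T i = twos b g T' i"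
  shows "T = T'"
proof (intro ext)
  fix i j
  show "T i j = T' i j"
  proof (cases "(i, j) \<in> skew b g")
    case True
    then show ?thesis
      using lr_tableau_two_iff[OF assms(1-3) True] lr_tableau_two_iff[OF assms(1,2,4) True]
        lr_tableau_values[OF assms(3) True] lr_tableau_values[OF assms(4) True] assms(5)[of i] by auto
  next
    case False
    then show ?thesis using lr_tableau_outside assms(3,4) by metis
  qed
qed

section \<open>Klein tableaux and their arc diagrams\<close>

lemma forget_eq [simp]:
  "forget P i j = 0 \<longleftrightarrow> P i j = KE"
  "forget P i j = Suc 0 \<longleftrightarrow> P i j = K1"
  "forget P i j = 2 \<longleftrightarrow> (\<exists>r. P i j = K2 r)"
  by (auto simp: forget_def split: kentry.splits)

lemma klein_lr_tableau: "klein a b g P \<Longrightarrow> lr_tableau a b g (forget P)"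
  by (simp add: klein_def)

lemma klein_subscript_bounds:
  assumes "klein a b g P" "P i j = K2 r"
  shows "1 \<le> r" "r < i"
proof -
  have "1 \<le> r \<and> r \<le> i - 1"
    using assms unfolding klein_def by (elim conjE) blast
  then show "1 \<le> r" "r < i" by auto
qed

lemma klein_below_one: "klein a b g P \<Longrightarrow> P i j = K2 r \<Longrightarrow> P (i - 1) j = K1 \<Longrightarrow> r = i - 1"
  unfolding klein_def by (elim conjE) blast

lemma klein_row_mono:
  "klein a b g P \<Longrightarrow> P i j = K2 r \<Longrightarrow> P i j' = K2 r' \<Longrightarrow> j < j' \<Longrightarrow> r \<le> r'"
  unfolding klein_def by (elim conjE) blast

lemma card_ones_row:
  "card {(i, j). (i, j) \<in> skew b g \<and> i = r \<and> P i j = K1} = ones_in_row b g (forget P) r"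
proof -
  have "{(i, j). (i, j) \<in> skew b g \<and> i = r \<and> P i j = K1} = Pair r ` {j. (r, j) \<in> skew b g \<and> P r j = K1}"
    by auto
  then show ?thesis by (simp add: ones_in_row_def card_image inj_on_def)
qed

lemma klein_count_le:
  assumes "klein a b g P"
  shows "count (image_mset snd (arcs b g P)) r \<le> ones_in_row b g (forget P) r"
  using assms unfolding klein_def count_snd_eq_card card_ones_row by (elim conjE) blast

lemma klein_in_skew:
  assumes "klein a b g P" "P i j \<noteq> KE"
  shows "(i, j) \<in> skew b g"
  using lr_tableau_outside[OF klein_lr_tableau[OF assms(1)]] assms(2) forget_eq(1) by blast

lemma count_poles:
  "count (poles b g P) i = ones_in_row b g (forget P) i - count (image_mset snd (arcs b g P)) i"
  unfolding poles_def count_diff count_fst_skew[where R = "\<lambda>i j. P i j = K1"] by (simp add: ones_in_row_def)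

lemma count_le_count_image: "count A y \<le> count (image_mset f A) (f y)"
  by (induction A) auto

text \<open>Poles are a truncated difference of multisets; condition (c) ensures that nothing is cut
  off, and therefore the degrees add up to the row sizes.\<close>

lemma klein_valid:
  assumes "klein a b g P"
  shows "valid (row_size b g) (overlap b g) (conj a 2) (arcs b g P) (poles b g P)"
  unfolding valid_def
proof (intro conjI allI impI)
  note lr = klein_lr_tableau[OF assms]
  fix m r assume "(m, r) \<in># arcs b g P"
  then have "0 < count (arcs b g P) (m, r)" by simp
  then obtain j where "P m j = K2 r"
    unfolding count_arcs_eq_card by (auto simp: card_gt_0_iff)
  then show "1 \<le> r" "r < m"
    using klein_subscript_bounds[OF assms] by blast+
next
  fix i
  show "count (image_mset fst (arcs b g P)) i + count (image_mset snd (arcs b g P)) i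
      + count (poles b g P) i = row_size b g i"
    using ones_plus_twos[OF klein_lr_tableau[OF assms], of i] klein_count_le[OF assms, of i]
    unfolding count_poles count_fst_eq_card by linarith
next
  show "size (arcs b g P) = conj a 2"
    using klein_lr_tableau[OF assms] unfolding size_arcs lr_tableau_def by (elim conjE)
next
  fix i
  show "overlap b g i \<le> count (arcs b g P) (Suc i, i)"
    unfolding overlap_def count_arcs_eq_card
  proof (rule card_mono)
    show "{j. (i, j) \<in> skew b g \<and> (Suc i, j) \<in> skew b g} \<subseteq> {j. (Suc i, j) \<in> skew b g \<and> P (Suc i) j = K2 i}"
    proof
      fix j assume "j \<in> {j. (i, j) \<in> skew b g \<and> (Suc i, j) \<in> skew b g}"
      then have j: "(i, j) \<in> skew b g" "(Suc i, j) \<in> skew b g" by auto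
      then have "forget P i j = Suc 0" "forget P (Suc i) j = 2"
        using lr_tableau_col[OF klein_lr_tableau[OF assms] j] by auto
      then obtain r where "P i j = K1" "P (Suc i) j = K2 r" by auto
      then show "j \<in> {j. (Suc i, j) \<in> skew b g \<and> P (Suc i) j = K2 i}"
        using klein_below_one[OF assms, of "Suc i" j r] j by auto
    qed
  qed simp
qed

section \<open>Rebuilding a Klein tableau from a valid diagram\<close>

definition row_list :: "(nat \<times> nat) multiset \<Rightarrow> nat \<Rightarrow> nat list" where
  "row_list A i = sorted_list_of_multiset (image_mset snd (filter_mset (\<lambda>x. fst x = i) A))"

text \<open>Inverse of the passage from Klein tableaux to arcs. Column \<open>c\<close> is the last
  one that may hold a 1; weak increase along rows puts the 2's to its right, with their subscripts
  in sorted order.\<close>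

definition tab :: "nat list \<Rightarrow> nat list \<Rightarrow> (nat \<times> nat) multiset \<Rightarrow> nat \<Rightarrow> nat \<Rightarrow> kentry" where
  "tab b g A i j = (let c = conj b i - count (image_mset fst A) i in
     if (i, j) \<notin> skew b g then KE else if j \<le> c then K1 else K2 (row_list A i ! (j - Suc c)))"

lemma sorted_row_list: "sorted (row_list A i)"
  by (simp add: row_list_def)

lemma length_row_list: "length (row_list A i) = count (image_mset fst A) i"
proof -
  have "length (row_list A i) = size (mset (row_list A i))" by simp
  also have "\<dots> = size (filter_mset (\<lambda>x. fst x = i) A)"
    unfolding row_list_def by (simp del: size_mset)
  also have "\<dots> = count (image_mset fst A) i"
    by (induction A) auto
  finally show ?thesis .
qed

lemma count_row_list: "count (mset (row_list A i)) r = count A (i, r)"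
proof -
  have "count (image_mset snd (filter_mset (\<lambda>x. fst x = i) A)) r = count A (i, r)"
    by (induction A) auto
  then show ?thesis by (simp add: row_list_def)
qed

lemma count_mset_eq_card_nth: "count (mset xs) y = card {p. p < length xs \<and> xs ! p = y}"
proof -
  have "count (mset xs) y = length (filter (\<lambda>z. z = y) xs)"
    by (induction xs) auto
  then show ?thesis by (simp only: length_filter_conv_card)
qed

lemma card_nth_row_list: "card {p. p < length (row_list A i) \<and> row_list A i ! p = r} = count A (i, r)"
  by (simp only: count_row_list[symmetric] count_mset_eq_card_nth)

text \<open>Read from left to right, the subscripts of a row form a sorted list with the multiset of
  \<open>row_list\<close>, and a multiset has only one sorted list. Hence the arcs determine the
  tableau.\<close>

lemma klein_eq_tab:
  assumes "is_partition b" "is_partition g" "klein a b g P"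
  shows "P = tab b g (arcs b g P)"
proof (intro ext)
  fix i j
  note lr = klein_lr_tableau[OF assms(3)]
  define u where "u = conj b i"
  define c where "c = u - count (image_mset fst (arcs b g P)) i"
  have two: "forget P i j' = 2 \<longleftrightarrow> c < j'" if "(i, j') \<in> skew b g" for j'
    using lr_tableau_two_iff[OF assms(1,2) lr that] by (simp add: c_def u_def count_fst_eq_card)
  show "P i j = tab b g (arcs b g P) i j"
  proof (cases "(i, j) \<in> skew b g \<and> c < j")
    case False
    have "P i j = K1" if "(i, j) \<in> skew b g" "\<not> c < j"
      using two[OF that(1)] that lr_tableau_values[OF lr that(1)] by auto
    moreover have "P i j = KE" if "(i, j) \<notin> skew b g"
      using that klein_in_skew[OF assms(3)] by blast
    ultimately show ?thesis
      using False by (auto simp: tab_def u_def[symmetric] c_def[symmetric])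
  next
    case True
    have i: "1 \<le> i" and ju: "j \<le> u"
      using True by (auto simp: u_def skew_iff[OF assms(1,2)])
    have "row_size b g i = u - conj g i" "conj g i < u"
      using row_size_eq[OF assms(1,2) i] True by (auto simp: u_def skew_iff[OF assms(1,2)])
    \<comment> \<open>The row has at least as many boxes as 2's, so each column after
      \<open>c\<close> up to \<open>u\<close> really has a box in this row.\<close>
    then have l: "conj g i \<le> c"
      using ones_plus_twos[OF lr, of i] True by (auto simp: c_def count_fst_eq_card)
    have K2: "(i, j') \<in> skew b g \<and> P i j' = K2 (subscr (P i j'))" if "c < j'" "j' \<le> u" for j'
    proof -
      have s: "(i, j') \<in> skew b g"
        using that l i by (simp add: u_def skew_iff[OF assms(1,2)])
      then have "forget P i j' = 2" using two that by blast
      then show ?thesis using s by (auto simp: subscr_def)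
    qed
    let ?f = "\<lambda>j. subscr (P i j)"
    define L where "L = map ?f [Suc c..<Suc u]"
    have "sorted L"
      unfolding L_def sorted_iff_nth_mono_less
    proof (intro allI impI)
      fix p q assume pq: "p < q" "q < length (map ?f [Suc c..<Suc u])"
      have "?f (Suc c + p) \<le> ?f (Suc c + q)"
        using K2[of "Suc c + p"] K2[of "Suc c + q"] pq
        by (simp del: upt_Suc) (intro klein_row_mono[OF assms(3), of i "Suc c + p" _ "Suc c + q"]; force)
      then show "map ?f [Suc c..<Suc u] ! p \<le> map ?f [Suc c..<Suc u] ! q"
        using pq by (simp del: upt_Suc)
    qed
    moreover have "mset L = mset (row_list (arcs b g P) i)"
    proof (rule multiset_eqI)
      fix r
      have "{j \<in> {Suc c..<Suc u}. ?f j = r} = {j. (i, j) \<in> skew b g \<and> P i j = K2 r}"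
      proof (intro set_eqI iffI)
        fix j' assume "j' \<in> {j \<in> {Suc c..<Suc u}. ?f j = r}"
        then show "j' \<in> {j. (i, j) \<in> skew b g \<and> P i j = K2 r}"
          using K2[of j'] by auto
      next
        fix j' assume j': "j' \<in> {j. (i, j) \<in> skew b g \<and> P i j = K2 r}"
        then have "c < j'" using two[of j'] by auto
        moreover have "j' \<le> u" using j' by (auto simp: u_def skew_iff[OF assms(1,2)])
        ultimately show "j' \<in> {j \<in> {Suc c..<Suc u}. ?f j = r}"
          using j' by (auto simp: subscr_def)
      qed
      moreover have "count (mset L) r = card {j \<in> {Suc c..<Suc u}. ?f j = r}"
        by (simp only: L_def mset_map mset_upt count_image_mset_set finite_atLeastLessThan)
      ultimately show "count (mset L) r = count (mset (row_list (arcs b g P) i)) r"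
        by (simp add: count_row_list count_arcs_eq_card)
    qed
    ultimately have "L = row_list (arcs b g P) i"
      using properties_for_sort[of L] sorted_row_list sorted_sort_id properties_for_sort by metis
    moreover have "L ! (j - Suc c) = ?f j"
      using True ju by (auto simp: L_def nth_map_upt simp del: upt_Suc)
    ultimately show ?thesis
      using K2[of j] True ju by (simp add: tab_def u_def[symmetric] c_def[symmetric])
  qed
qed

lemma klein_eqI:
  assumes "is_partition b" "is_partition g" "klein a b g P" "klein a b g P'" "arcs b g P = arcs b g P'"
  shows "P = P'"
  using klein_eq_tab assms by metis

lemma forget_eq_iff:
  assumes "is_partition b" "is_partition g" "klein a b g P" "klein a b g P'"
  shows "forget P = forget P' \<longleftrightarrow> image_mset fst (arcs b g P) = image_mset fst (arcs b g P')"
proof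
  assume "forget P = forget P'"
  then show "image_mset fst (arcs b g P) = image_mset fst (arcs b g P')"
    by (intro multiset_eqI) (simp only: count_fst_eq_card)
next
  assume "image_mset fst (arcs b g P) = image_mset fst (arcs b g P')"
  then show "forget P = forget P'"
    using assms klein_lr_tableau count_fst_eq_card
    by (intro lr_tableau_eqI[OF assms(1,2)]) (blast, blast, metis)
qed

text \<open>Let \<open>m\<close> be the last row with a 2 to the right of column \<open>c\<close>.
  Every 1 above row \<open>m\<close> in a column up to \<open>c\<close> has a 2 of row
  \<open>m\<close> directly below it. So dropping these columns from the row inequality for
  \<open>m\<close> removes at least as many 2's as 1's.\<close>

lemma lattice_of_row_sums:
  assumes "is_partition b" "is_partition g"
    and col: "\<And>i i' j. (i, j) \<in> skew b g \<Longrightarrow> (i', j) \<in> skew b g \<Longrightarrow> i < i' \<Longrightarrow>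
      i' = Suc i \<and> T i j = 1 \<and> T i' j = (2::nat)"
    and sums: "\<And>m. card {(i, j). (i, j) \<in> skew b g \<and> i \<in> {..m} \<and> T i j = 2}
      \<le> card {(i, j). (i, j) \<in> skew b g \<and> i \<in> {..<m} \<and> T i j = 1}"
  shows "card {(i, j). (i, j) \<in> skew b g \<and> c < j \<and> T i j = 2}
          \<le> card {(i, j). (i, j) \<in> skew b g \<and> c < j \<and> T i j = 1}"
proof (cases "{(i, j). (i, j) \<in> skew b g \<and> c < j \<and> T i j = 2} = {}")
  case False
  let ?S2 = "{(i, j). (i, j) \<in> skew b g \<and> c < j \<and> T i j = 2}"
  let ?S1 = "{(i, j). (i, j) \<in> skew b g \<and> c < j \<and> T i j = 1}"
  define m where "m = Max (fst ` ?S2)"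
  have "m \<in> fst ` ?S2"
    unfolding m_def by (rule Max_in) (use False in auto)
  then obtain j0 where j0: "(m, j0) \<in> skew b g" "c < j0" by auto
  have max: "i \<le> m" if "(i, j) \<in> ?S2" for i j
    unfolding m_def using that by (intro Max_ge) (auto intro: rev_image_eqI)
  let ?R = "{(i, j). (i, j) \<in> skew b g \<and> i = m \<and> j \<le> c \<and> T i j = 2}"
  let ?O = "{(i, j). (i, j) \<in> skew b g \<and> i < m \<and> j \<le> c \<and> T i j = 1}"
  have below: "(m, j) \<in> ?R \<and> m = Suc i" if "(i, j) \<in> ?O" for i j
  proof -
    have "conj g m \<le> conj g i" using that by (intro conj_antimono) auto
    then have "(m, j) \<in> skew b g"
      using that j0 by (auto simp: skew_iff[OF assms(1,2)])
    then show ?thesis using that col[of i j m] by auto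
  qed
  have "card ?O \<le> card ?R"
  proof (rule card_inj_on_le)
    show "inj_on (\<lambda>(i, j). (m, j)) ?O"
      using below by (auto simp: inj_on_def)
    show "(\<lambda>(i, j). (m, j)) ` ?O \<subseteq> ?R" using below by auto
  qed simp
  moreover have "card ?S2 + card ?R \<le> card {(i, j). (i, j) \<in> skew b g \<and> i \<in> {..m} \<and> T i j = 2}"
    by (subst card_Un_disjoint[symmetric]) (use max in \<open>auto intro!: card_mono\<close>)
  moreover have "card {(i, j). (i, j) \<in> skew b g \<and> i \<in> {..<m} \<and> T i j = 1} \<le> card (?S1 \<union> ?O)"
    by (rule card_mono) auto
  moreover have "card (?S1 \<union> ?O) \<le> card ?S1 + card ?O" by (rule card_Un_le)
  ultimately show ?thesis using sums[of m] by linarith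
qed (simp only: card.empty)

text \<open>Copies of the maximum fill the end of a sorted list. This serves condition (b): the
  boxes of row \<open>i\<close> lying under row \<open>i - 1\<close> are the last ones of the row,
  and \<open>i - 1\<close> is the largest subscript allowed there.\<close>

lemma sorted_nth_eq_max:
  fixes xs :: "nat list"
  assumes "sorted xs" "\<And>y. y \<in> set xs \<Longrightarrow> y \<le> M" "k \<le> count (mset xs) M"
    "length xs \<le> p + k" "p < length xs"
  shows "xs ! p = M"
proof (rule ccontr)
  assume "xs ! p \<noteq> M"
  then have less: "xs ! p < M" using assms(2)[of "xs ! p"] assms(5) by simp
  have "{q. q < length xs \<and> xs ! q = M} \<subseteq> {p<..<length xs}"
  proof clarify
    fix q assume q: "q < length xs" "M = xs ! q"
    then show "q \<in> {p<..<length xs}"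
      using sorted_nth_mono[OF assms(1), of q p] less assms(5) by force
  qed
  then have "card {q. q < length xs \<and> xs ! q = M} \<le> length xs - Suc p"
    using card_mono[of "{p<..<length xs}"] by fastforce
  moreover have "count (mset xs) M = card {q. q < length xs \<and> xs ! q = M}"
    by (rule count_mset_eq_card_nth)
  ultimately show False using assms(3-5) by linarith
qed

lemma card_ones_plus_twos:
  assumes "\<And>i j. (i, j) \<in> skew b g \<Longrightarrow> T i j = 1 \<or> T i j = (2::nat)"
  shows "card {(i, j). (i, j) \<in> skew b g \<and> T i j = 1} + card {(i, j). (i, j) \<in> skew b g \<and> T i j = 2}
    = card (skew b g)"
proof -
  have "skew b g = {(i, j). (i, j) \<in> skew b g \<and> T i j = 1} \<union> {(i, j). (i, j) \<in> skew b g \<and> T i j = 2}"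
    using assms by auto
  then have "card (skew b g) = card ({(i, j). (i, j) \<in> skew b g \<and> T i j = 1} \<union> {(i, j). (i, j) \<in> skew b g \<and> T i j = 2})"
    by (rule arg_cong)
  then show ?thesis
    by (simp add: card_Un_disjoint disjoint_iff)
qed

lemma valid_arc: "valid x k N A Q \<Longrightarrow> (m, r) \<in># A \<Longrightarrow> 1 \<le> r \<and> r < m"
  by (simp add: valid_def)

lemma valid_degree:
  "valid x k N A Q \<Longrightarrow> count (image_mset fst A) i + count (image_mset snd A) i + count Q i = x i"
  by (simp add: valid_def)

lemma valid_forced: "valid x k N A Q \<Longrightarrow> k i \<le> count A (Suc i, i)"
  by (simp add: valid_def)

lemma valid_size: "valid x k N A Q \<Longrightarrow> size A = N"
  by (simp add: valid_def)

text \<open>An arc starting in a row up to \<open>m\<close> ends in a row before \<open>m\<close>.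
  This gives the row inequalities from which the lattice condition follows.\<close>

lemma sum_starts_le_sum_ends:
  assumes "valid x k N A Q"
  shows "(\<Sum>i\<in>{..m}. count (image_mset fst A) i) \<le> (\<Sum>i\<in>{..<m}. count (image_mset snd A) i)"
proof -
  have "filter_mset (\<lambda>x. fst x \<in> {..m}) A = filter_mset (\<lambda>x. fst x \<in> {..m}) (filter_mset (\<lambda>x. snd x \<in> {..<m}) A)"
    unfolding filter_filter_mset
    by (rule filter_mset_cong) (use valid_arc[OF assms] in force)+
  then have "size (filter_mset (\<lambda>x. fst x \<in> {..m}) A) \<le> size (filter_mset (\<lambda>x. snd x \<in> {..<m}) A)"
    by (metis multiset_filter_subset size_mset_mono)
  then show ?thesis
    by (simp only: size_filter_eq_sum_count finite_atMost finite_lessThan)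
qed

lemma tab_K2_iff:
  assumes "is_partition b" "is_partition g" "valid (row_size b g) k N A Q"
    and "c = conj b i - count (image_mset fst A) i" "(i, j) \<in> skew b g" "c < j"
  shows "tab b g A i j = K2 (row_list A i ! (j - Suc c))" "j - Suc c < length (row_list A i)"
proof -
  have *: "1 \<le> i" "conj g i < j" "j \<le> conj b i"
    using assms(5) by (auto simp: skew_iff[OF assms(1,2)])
  have "count (image_mset fst A) i \<le> conj b i - conj g i"
    using valid_degree[OF assms(3), of i] row_size_eq[OF assms(1,2) *(1)] by linarith
  then show "j - Suc c < length (row_list A i)"
    using * assms(4,6) by (auto simp: length_row_list)
  show "tab b g A i j = K2 (row_list A i ! (j - Suc c))"
    using assms(4-6) by (auto simp: tab_def)
qed

lemma arcs_tab:
  assumes "is_partition b" "is_partition g" "valid (row_size b g) k N A Q"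
  shows "arcs b g (tab b g A) = A"
proof (rule multiset_eqI)
  fix e :: "nat \<times> nat"
  obtain i r where e: "e = (i, r)" by (cases e)
  define c where "c = conj b i - count (image_mset fst A) i"
  have "{j. (i, j) \<in> skew b g \<and> tab b g A i j = K2 r}
      = (\<lambda>p. p + Suc c) ` {p. p < length (row_list A i) \<and> row_list A i ! p = r}" (is "?L = ?R")
  proof (cases "1 \<le> i")
    case False
    then have i: "i = 0" by simp
    then have "length (row_list A i) = 0"
      using valid_degree[OF assms(3), of 0] by (simp add: length_row_list row_size_0)
    then show ?thesis using i by (auto simp: skew_def)
  next
    case True
    have len: "count (image_mset fst A) i \<le> conj b i - conj g i"
      using valid_degree[OF assms(3), of i] row_size_eq[OF assms(1,2) True] by linarith
    show ?thesis
    proof (intro set_eqI iffI)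
      fix j assume "j \<in> ?L"
      then have j: "(i, j) \<in> skew b g" "tab b g A i j = K2 r" by auto
      then have "c < j" by (auto simp: tab_def c_def Let_def split: if_splits)
      then show "j \<in> ?R"
        using tab_K2_iff[OF assms c_def j(1)] j(2)
        by (intro image_eqI[of _ _ "j - Suc c"]) auto
    next
      fix j assume "j \<in> ?R"
      then obtain p where p: "j = p + Suc c" "p < length (row_list A i)" "row_list A i ! p = r" by auto
      then have "(i, j) \<in> skew b g"
        using len True by (auto simp: skew_iff[OF assms(1,2)] length_row_list c_def)
      then show "j \<in> ?L"
        using tab_K2_iff(1)[OF assms c_def, of j] p by auto
    qed
  qed
  moreover have "card ?R = card {p. p < length (row_list A i) \<and> row_list A i ! p = r}"
    by (rule card_image) (auto simp: inj_on_def)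
  ultimately have "count (arcs b g (tab b g A)) (i, r) = count A (i, r)"
    by (simp only: count_arcs_eq_card card_nth_row_list)
  then show "count (arcs b g (tab b g A)) e = count A e" by (simp add: e)
qed

text \<open>The diagram supplies the conditions on entries and subscripts. \<open>T\<close>
  contributes facts about the shape: no column has three boxes, and the total number of boxes is
  known, which yields the number of 1's.\<close>

lemma tab_klein:
  assumes "is_partition b" "is_partition g" "lr_tableau a b g T"
    and valid: "valid (row_size b g) (overlap b g) (conj a 2) A Q"
  shows "klein a b g (tab b g A)" "arc_diagram b g (tab b g A) = (A, Q)"
proof -
  define P where "P = tab b g A"
  define c where "c i = conj b i - count (image_mset fst A) i" for i
  have arcs: "arcs b g P = A"
    unfolding P_def by (rule arcs_tab[OF assms(1,2) valid])
  have K1: "P i j = K1" if "(i, j) \<in> skew b g" "j \<le> c i" for i j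
    using that by (simp add: P_def tab_def c_def)
  have K2: "P i j = K2 (row_list A i ! (j - Suc (c i)))" "j - Suc (c i) < length (row_list A i)"
    if "(i, j) \<in> skew b g" "c i < j" for i j
    using tab_K2_iff[OF assms(1,2) valid c_def that] by (auto simp: P_def)
  have KE: "P i j = KE" if "(i, j) \<notin> skew b g" for i j
    using that by (simp add: P_def tab_def)
  have K2_D: "(i, j) \<in> skew b g" "c i < j" if "P i j = K2 r" for i j r
    using that K1 KE by (metis kentry.distinct(3), metis kentry.distinct(5) leI KE kentry.distinct(3))
  have vals: "forget P i j = 1 \<or> forget P i j = 2" if "(i, j) \<in> skew b g" for i j
    using K1[OF that] K2(1)[OF that] by (cases "j \<le> c i") auto
  have col: "i' = Suc i \<and> forget P i j = 1 \<and> forget P i' j = 2"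
    if s: "(i, j) \<in> skew b g" "(i', j) \<in> skew b g" "i < i'" for i i' j
  proof -
    have "i' = Suc i"
    proof (rule ccontr)
      assume "i' \<noteq> Suc i"
      then have i': "Suc i < i'" using s by simp
      have "conj g (Suc i) \<le> conj g i" "conj b i' \<le> conj b (Suc i)"
        using i' by (auto intro: conj_antimono)
      then have "(Suc i, j) \<in> skew b g"
        using s by (auto simp: skew_iff[OF assms(1,2)])
      then show False
        using lr_tableau_col(2)[OF assms(3) s(1), of "Suc i"] lr_tableau_col(1)[OF assms(3) _ s(2) i'] by auto
    qed
    moreover have j: "1 \<le> i" "conj g i < j" "j \<le> conj b (Suc i)"
      using s calculation by (auto simp: skew_iff[OF assms(1,2)])
    \<comment> \<open>The columns shared by rows \<open>i\<close> and \<open>i + 1\<close> are the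
      first of row \<open>i\<close> and the last of row \<open>i + 1\<close>. That many arcs from
      \<open>i + 1\<close> to \<open>i\<close> give enough 2's to fill them below, and enough boxes
      other than 2 to fill them above.\<close>
    have "conj b (Suc i) - conj g i \<le> count A (Suc i, i)"
      using valid_forced[OF valid, of i] overlap_eq[OF assms(1,2) j(1)] by simp
    moreover have "count A (Suc i, i) \<le> count (image_mset fst A) (Suc i)"
      "count A (Suc i, i) \<le> count (image_mset snd A) i"
      using count_le_count_image[of A "(Suc i, i)" fst] count_le_count_image[of A "(Suc i, i)" snd] by auto
    moreover have "count (image_mset fst A) i + count (image_mset snd A) i \<le> conj b i - conj g i"
      using valid_degree[OF valid, of i] row_size_eq[OF assms(1,2) j(1)] by linarith
    ultimately have "c (Suc i) < j" "j \<le> c i"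
      using j conj_antimono[of i "Suc i" b] unfolding c_def by linarith+
    then show ?thesis
      using K1[OF s(1)] K2(1)[OF s(2)] \<open>i' = Suc i\<close> by auto
  qed
  have twos: "twos b g (forget P) i = count (image_mset fst A) i" for i
    by (simp only: arcs[symmetric] count_fst_eq_card)
  have ones: "ones_in_row b g (forget P) i = count (image_mset snd A) i + count Q i" for i
  proof -
    have "{j. (i, j) \<in> skew b g} = {j. (i, j) \<in> skew b g \<and> forget P i j = 1} \<union> {j. (i, j) \<in> skew b g \<and> forget P i j = 2}"
      using vals by blast
    then have "row_size b g i = card ({j. (i, j) \<in> skew b g \<and> forget P i j = 1} \<union> {j. (i, j) \<in> skew b g \<and> forget P i j = 2})"
      unfolding row_size_def by (rule arg_cong)
    also have "\<dots> = ones_in_row b g (forget P) i + twos b g (forget P) i"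
      unfolding ones_in_row_def by (rule card_Un_disjoint) auto
    finally show ?thesis
      using valid_degree[OF valid, of i] twos[of i] by linarith
  qed
  have card2: "card {(i, j). (i, j) \<in> skew b g \<and> forget P i j = 2} = conj a 2"
    using valid_size[OF valid] by (simp only: size_arcs[symmetric] arcs)
  have "lr_tableau a b g (forget P)"
    unfolding lr_tableau_def
  proof (intro conjI allI impI)
    have "card {(i, j). (i, j) \<in> skew b g \<and> T i j = 1} + card {(i, j). (i, j) \<in> skew b g \<and> T i j = 2} = card (skew b g)"
      using lr_tableau_values[OF assms(3)] by (rule card_ones_plus_twos)
    moreover have "card {(i, j). (i, j) \<in> skew b g \<and> forget P i j = 1}
        + card {(i, j). (i, j) \<in> skew b g \<and> forget P i j = 2} = card (skew b g)"
      using vals by (rule card_ones_plus_twos)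
    moreover have "card {(i, j). (i, j) \<in> skew b g \<and> T i j = 1} = conj a 1"
      "card {(i, j). (i, j) \<in> skew b g \<and> T i j = 2} = conj a 2"
      using assms(3) unfolding lr_tableau_def by blast+
    ultimately show "card {(i, j). (i, j) \<in> skew b g \<and> forget P i j = 1} = conj a 1"
      using card2 by linarith
  next
    fix i j j' assume s: "(i, j) \<in> skew b g" "(i, j') \<in> skew b g" "j < j'"
    show "forget P i j \<le> forget P i j'"
    proof (cases "j \<le> c i")
      case True
      then show ?thesis using K1[OF s(1)] vals[OF s(2)] by (auto simp: forget_def)
    next
      case False
      then show ?thesis using K2(1)[OF s(1)] K2(1)[OF s(2)] s(3) by (simp add: forget_def)
    qed
  next
    fix d
    show "card {(i, j). (i, j) \<in> skew b g \<and> d < j \<and> forget P i j = 2}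
        \<le> card {(i, j). (i, j) \<in> skew b g \<and> d < j \<and> forget P i j = 1}"
    proof (rule lattice_of_row_sums[OF assms(1,2) col])
      fix m
      have "(\<Sum>i\<in>{..m}. count (image_mset fst A) i) \<le> (\<Sum>i\<in>{..<m}. count (image_mset snd A) i)"
        by (rule sum_starts_le_sum_ends[OF valid])
      also have "\<dots> \<le> (\<Sum>i\<in>{..<m}. ones_in_row b g (forget P) i)"
        by (rule sum_mono) (simp add: ones)
      finally show "card {(i, j). (i, j) \<in> skew b g \<and> i \<in> {..m} \<and> forget P i j = 2}
          \<le> card {(i, j). (i, j) \<in> skew b g \<and> i \<in> {..<m} \<and> forget P i j = 1}"
        by (simp only: card_row_sum finite_atMost finite_lessThan twos ones_in_row_def)
    qed
  qed (use KE vals card2 col in \<open>auto simp: forget_def\<close>)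
  moreover have range: "1 \<le> r \<and> r \<le> i - 1" if "P i j = K2 r" for i j r
  proof -
    have "j \<in> {j. (i, j) \<in> skew b g \<and> P i j = K2 r}" using K2_D(1)[OF that] that by simp
    then have "0 < count A (i, r)"
      unfolding arcs[symmetric] count_arcs_eq_card by (subst card_gt_0_iff) auto
    then show ?thesis using valid_arc[OF valid, of i r] by auto
  qed
  moreover have "r = i - 1" if P: "P i j = K2 r" "P (i - 1) j = K1" for i j r
  proof -
    have s: "(i, j) \<in> skew b g" "(i - 1, j) \<in> skew b g" "c i < j"
      using K2_D[OF P(1)] KE[of "i - 1" j] P(2) by auto
    then have i: "1 \<le> i - 1" "i = Suc (i - 1)" by (auto dest: skew_bounds)
    have j: "conj g (i - 1) < j" "j \<le> conj b i"
      using s by (auto simp: skew_iff[OF assms(1,2)])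
    have "overlap b g (i - 1) = conj b i - conj g (i - 1)"
      using overlap_eq[OF assms(1,2) i(1)] i(2) by simp
    then have k: "conj b i - conj g (i - 1) \<le> count A (i, i - 1)"
      using valid_forced[OF valid, of "i - 1"] i(2) by simp
    have "row_list A i ! (j - Suc (c i)) = i - 1"
    proof (rule sorted_nth_eq_max[OF sorted_row_list])
      show "conj b i - conj g (i - 1) \<le> count (mset (row_list A i)) (i - 1)"
        using k by (simp only: count_row_list)
      show "j - Suc (c i) < length (row_list A i)" by (rule K2(2)[OF s(1,3)])
      show "length (row_list A i) \<le> j - Suc (c i) + (conj b i - conj g (i - 1))"
        using j s(3) valid_degree[OF valid, of i] row_size_eq[OF assms(1,2), of i] i
        unfolding length_row_list c_def by linarith
    next
      fix y assume "y \<in> set (row_list A i)"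
      then have "0 < count (mset (row_list A i)) y" by simp
      then have "(i, y) \<in># A" by (simp only: count_row_list count_greater_zero_iff)
      then show "y \<le> i - 1" using valid_arc[OF valid] by fastforce
    qed
    then show ?thesis using K2(1)[OF s(1,3)] P(1) by simp
  qed
  moreover have "card {(i, j). (i, j) \<in> skew b g \<and> P i j = K2 r}
          \<le> card {(i, j). (i, j) \<in> skew b g \<and> i = r \<and> P i j = K1}" for r
    unfolding card_ones_row count_snd_eq_card[symmetric] arcs ones by simp
  moreover have "r \<le> r'" if P: "P i j = K2 r" "P i j' = K2 r'" "j < j'" for i j j' r r'
  proof -
    note D = K2_D[OF P(1)] K2_D[OF P(2)]
    have "row_list A i ! (j - Suc (c i)) \<le> row_list A i ! (j' - Suc (c i))"
      using P(3) K2(2)[OF D(3,4)] by (intro sorted_nth_mono[OF sorted_row_list]) auto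
    then show ?thesis
      using K2(1)[OF D(1,2)] K2(1)[OF D(3,4)] P by simp
  qed
  ultimately show "klein a b g (tab b g A)"
    unfolding klein_def P_def[symmetric] by blast
  have "poles b g P = Q"
    by (rule multiset_eqI) (simp only: count_poles arcs ones add_diff_cancel_left')
  then show "arc_diagram b g (tab b g A) = (A, Q)"
    using arcs by (simp add: arc_diagram_def P_def)
qed

section \<open>Moves on arc diagrams\<close>

lemma arc_move_A:
  "s < r \<Longrightarrow> r < n \<Longrightarrow> n < m \<Longrightarrow>
    arc_move (add_mset (m, r) (add_mset (n, s) A), Q) (add_mset (m, s) (add_mset (n, r) A), Q)"
  unfolding arc_move_def Let_def fst_conv snd_conv
  by (rule disjI1, rule exI[of _ m], rule exI[of _ n], rule exI[of _ r], rule exI[of _ s]) simp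

lemma arc_move_B:
  "s < r \<Longrightarrow> r < m \<Longrightarrow>
    arc_move (add_mset (m, s) A, add_mset r Q) (add_mset (m, r) A, add_mset s Q)"
  unfolding arc_move_def Let_def fst_conv snd_conv
  by (rule disjI2, rule exI[of _ m], rule exI[of _ r], rule exI[of _ s]) simp

lemma arc_move_C:
  "s < r \<Longrightarrow> r < n \<Longrightarrow> n < m \<Longrightarrow>
    arc_move (add_mset (m, r) (add_mset (n, s) A), Q) (add_mset (m, n) (add_mset (r, s) A), Q)"
  unfolding arc_move_def Let_def fst_conv snd_conv
  by (rule disjI1, rule exI[of _ m], rule exI[of _ n], rule exI[of _ r], rule exI[of _ s]) simp

lemma arc_move_D:
  "s < r \<Longrightarrow> r < m \<Longrightarrow>
    arc_move (add_mset (m, s) A, add_mset r Q) (add_mset (r, s) A, add_mset m Q)"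
  unfolding arc_move_def Let_def fst_conv snd_conv
  by (rule disjI2, rule exI[of _ m], rule exI[of _ r], rule exI[of _ s]) simp

text \<open>The split is by the configuration a move needs, which (A) shares with (C) and (B) with
  (D). Naming the untouched rest \<open>A0\<close> removes multiset subtraction from later
  arguments.\<close>

lemma arc_move_cases:
  assumes "arc_move (A, Q) (A', Q')"
  obtains (crossing) m n r s A0 where "s < r" "r < n" "n < m"
      "A = add_mset (m, r) (add_mset (n, s) A0)" "Q' = Q"
      "A' = add_mset (m, s) (add_mset (n, r) A0) \<or> A' = add_mset (m, n) (add_mset (r, s) A0)"
    | (covered_pole) m r s A0 Q0 where "s < r" "r < m" "A = add_mset (m, s) A0" "Q = add_mset r Q0"
      "A' = add_mset (m, r) A0 \<and> Q' = add_mset s Q0 \<or> A' = add_mset (r, s) A0 \<and> Q' = add_mset m Q0"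
proof -
  consider (1) m n r s where "s < r" "r < n" "n < m" "{#(m, r), (n, s)#} \<subseteq># A" "Q' = Q"
      "A' = A - {#(m, r), (n, s)#} + {#(m, s), (n, r)#} \<or> A' = A - {#(m, r), (n, s)#} + {#(m, n), (r, s)#}"
    | (2) m r s where "s < r" "r < m" "(m, s) \<in># A" "r \<in># Q"
      "A' = A - {#(m, s)#} + {#(m, r)#} \<and> Q' = Q - {#r#} + {#s#} \<or>
       A' = A - {#(m, s)#} + {#(r, s)#} \<and> Q' = Q - {#r#} + {#m#}"
    using assms unfolding arc_move_def Let_def fst_conv snd_conv by blast
  then show thesis
  proof cases
    case 1
    then obtain A0 where "A = {#(m, r), (n, s)#} + A0" by (metis subset_mset.le_iff_add)
    then show thesis using crossing[of s r n m A0] 1 by auto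
  next
    case 2
    obtain A0 Q0 where "A = add_mset (m, s) A0" "Q = add_mset r Q0"
      using 2 by (meson multi_member_split)
    then show thesis using covered_pole[of s r m A0 Q0] 2 by auto
  qed
qed

text \<open>Moves (C) and (D) lower the sum of the starting points of the arcs, but may raise the sum of the
  products \<open>m * r\<close>; the weights \<open>K + 1\<close> and \<open>K\<close> make the former win and take care of move (B).\<close>

definition potential :: "nat \<Rightarrow> (nat \<times> nat) multiset \<times> nat multiset \<Rightarrow> nat" where
  "potential K D = (\<Sum>(m, r)\<in>#fst D. m * r + Suc K * m) + K * \<Sum>\<^sub># (snd D)"

text \<open>(A) lowers the potential by \<open>(m - n) * (r - s)\<close>, (C) by
  \<open>(K + 1 - (m - s)) * (n - r)\<close>, (B) by \<open>(K - m) * (r - s)\<close> and (D) by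
  \<open>(m - r) * (s + 1)\<close>. The bound \<open>m < K\<close> makes the second and third
  positive; the extra 1 in \<open>Suc K\<close> keeps the last positive for
  \<open>s = 0\<close>.\<close>

lemma arc_move_potential:
  assumes "arc_move D D'" "\<forall>(m, r)\<in>#fst D. m < K"
  shows "potential K D' < potential K D" "\<forall>(m, r)\<in>#fst D'. m < K"
proof -
  obtain A Q A' Q' where D: "D = (A, Q)" "D' = (A', Q')" by (metis surj_pair)
  from assms(1)[unfolded D] have "potential K D' < potential K D \<and> (\<forall>(m, r)\<in>#fst D'. m < K)"
  proof (cases rule: arc_move_cases)
    case (crossing m n r s A0)
    obtain p where p: "n = r + Suc p" using crossing(2) less_iff_Suc_add by auto
    obtain q where q: "m = n + Suc q" using crossing(3) less_iff_Suc_add by auto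
    obtain d where d: "r = s + Suc d" using crossing(1) less_iff_Suc_add by auto
    have m: "m < K" using assms(2) crossing by (simp add: D)
    have A: "m * s + n * r < m * r + n * s"
      unfolding q d by (simp add: algebra_simps)
    have "(m - s) * (n - r) \<le> K * (n - r)" using m by (intro mult_right_mono) auto
    also have "\<dots> < Suc K * (n - r)" using crossing(2) by simp
    finally have "m * n + r * s + Suc K * (m + r) < m * r + n * s + Suc K * (m + n)"
      unfolding q p d by (simp add: algebra_simps)
    then show ?thesis
      using crossing A assms(2) by (auto simp: potential_def D algebra_simps)
  next
    case (covered_pole m r s A0 Q0)
    obtain q where q: "m = r + Suc q" using covered_pole(2) less_iff_Suc_add by auto
    obtain d where d: "r = s + Suc d" using covered_pole(1) less_iff_Suc_add by auto
    have m: "m < K" using assms(2) covered_pole by (simp add: D)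
    then have "m * Suc d < K * Suc d" by (intro mult_strict_right_mono) auto
    then have B: "m * r + K * s < m * s + K * r"
      unfolding d by (simp add: algebra_simps)
    have C: "r * s + Suc K * r + K * m < m * s + Suc K * m + K * r"
      unfolding q by (simp add: algebra_simps)
    show ?thesis
      using covered_pole B C assms(2) by (auto simp: potential_def D algebra_simps)
  qed
  then show "potential K D' < potential K D" "\<forall>(m, r)\<in>#fst D'. m < K" by auto
qed

lemma arc_moves_potential:
  assumes "arc_move\<^sup>*\<^sup>* D D'" "\<forall>(m, r)\<in>#fst D. m < K"
  shows "D' = D \<or> potential K D' < potential K D"
proof -
  have "(D' = D \<or> potential K D' < potential K D) \<and> (\<forall>(m, r)\<in>#fst D'. m < K)"
    using assms(1)
  proof (induction rule: rtranclp_induct)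
    case base
    then show ?case using assms(2) by simp
  next
    case (step D' D'')
    then show ?case using arc_move_potential[OF step(2)] by (metis order.strict_trans)
  qed
  then show ?thesis by blast
qed

text \<open>An arc which an inverse move may remove without violating condition (b).\<close>

definition free :: "(nat \<Rightarrow> nat) \<Rightarrow> (nat \<times> nat) multiset \<Rightarrow> nat \<Rightarrow> nat \<Rightarrow> bool" where
  "free k A m r \<longleftrightarrow> (m, r) \<in># A \<and> (m = Suc r \<longrightarrow> k r < count A (m, r))"

section \<open>Carrying out moves and inverse moves within the valid diagrams\<close>

lemma split_two:
  assumes "e \<in># A" "f \<in># A" "e \<noteq> f"
  obtains A0 where "A = add_mset e (add_mset f A0)"
proof -
  obtain B where B: "A = add_mset e B" using assms(1) by (meson multi_member_split)
  then have "f \<in># B" using assms(2,3) by simp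
  then obtain A0 where "B = add_mset f A0" by (meson multi_member_split)
  then show thesis using that B by blast
qed

text \<open>Common form of all moves: \<open>R\<close> is replaced by \<open>R'\<close> next to an
  unchanged rest \<open>A0\<close>, with the same incidences at every position. Only the loss of an
  arc between neighbouring rows can violate the forced counts.\<close>

lemma valid_exchange:
  assumes v: "valid x k N (R + A0) Q"
    and new: "\<forall>(m, r)\<in>#R'. 1 \<le> r \<and> r < m"
    and degree: "image_mset fst R' + image_mset snd R' + Q' = image_mset fst R + image_mset snd R + Q"
    and size: "size R' = size R"
    and forced: "\<And>i. (Suc i, i) \<in># R \<Longrightarrow> k i \<le> count A0 (Suc i, i)"
  shows "valid x k N (R' + A0) Q'"
  unfolding valid_def
proof (intro conjI allI impI)
  show "1 \<le> r" "r < m" if "(m, r) \<in># R' + A0" for m r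
    using that new valid_arc[OF v, of m r] by auto
  show "count (image_mset fst (R' + A0)) i + count (image_mset snd (R' + A0)) i + count Q' i = x i" for i
    using arg_cong[OF degree, of "\<lambda>M. count M i"] valid_degree[OF v, of i] by simp
  show "size (R' + A0) = N" using size valid_size[OF v] by simp
  show "k i \<le> count (R' + A0) (Suc i, i)" for i
    using forced[of i] valid_forced[OF v, of i]
    by (cases "(Suc i, i) \<in># R") (auto simp: not_in_iff)
qed

lemma move_down_crossing:
  assumes v: "valid x k N A Q" and mem: "(m, r) \<in># A" "(n, s) \<in># A" and less: "s < r" "r < n" "n < m"
  shows "\<exists>A' Q'. valid x k N A' Q' \<and> arc_move (A, Q) (A', Q') \<and> image_mset fst A' = image_mset fst A"
proof -
  obtain A0 where A: "A = add_mset (m, r) (add_mset (n, s) A0)"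
    using split_two[of "(m, r)" A "(n, s)"] mem less by (auto simp: free_def)
  have pos: "1 \<le> r" "1 \<le> s" using valid_arc[OF v] by (auto simp: A)
  have "valid x k N ({#(m, s), (n, r)#} + A0) Q"
  proof (rule valid_exchange)
    show "valid x k N ({#(m, r), (n, s)#} + A0) Q" using v by (simp add: A)
    show "\<forall>(m, r)\<in>#{#(m, s), (n, r)#}. 1 \<le> r \<and> r < m" using pos less by simp
    \<comment> \<open>Vacuous: \<open>n\<close> lies strictly inside the first removed arc and
      \<open>r\<close> inside the second, so neither joins neighbouring rows.\<close>
    show "k i \<le> count A0 (Suc i, i)" if "(Suc i, i) \<in># {#(m, r), (n, s)#}" for i
      using that less by auto
  qed (simp_all add: add_mset_commute)
  then show ?thesis
    using arc_move_A[OF less, of A0 Q] by (intro exI[of _ "{#(m, s), (n, r)#} + A0"] exI[of _ Q]) (simp add: A)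
qed

text \<open>Only the inner arc can join neighbouring rows, so only it has to be free; the outer one
  spans at least three.\<close>

lemma move_up_nested:
  assumes v: "valid x k N A Q" and mem: "(m, s) \<in># A" "free k A n r" and less: "s < r" "r < n" "n < m"
  shows "\<exists>A' Q'. valid x k N A' Q' \<and> arc_move (A', Q') (A, Q) \<and> image_mset fst A' = image_mset fst A"
proof -
  obtain A0 where A: "A = add_mset (m, s) (add_mset (n, r) A0)"
    using split_two[of "(m, s)" A "(n, r)"] mem less by (auto simp: free_def)
  have pos: "1 \<le> s" "1 \<le> r" using valid_arc[OF v] by (auto simp: A)
  have forced: "k r \<le> count A0 (n, r)" if "n = Suc r"
    using mem(2) less that by (simp add: free_def A split: if_splits)
  have "valid x k N ({#(m, r), (n, s)#} + A0) Q"
  proof (rule valid_exchange)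
    show "valid x k N ({#(m, s), (n, r)#} + A0) Q" using v by (simp add: A)
    show "\<forall>(m, r)\<in>#{#(m, r), (n, s)#}. 1 \<le> r \<and> r < m" using pos less by simp
    show "k i \<le> count A0 (Suc i, i)" if "(Suc i, i) \<in># {#(m, s), (n, r)#}" for i
      using that less forced by auto
  qed (simp_all add: add_mset_commute)
  then show ?thesis
    using arc_move_A[OF less, of A0 Q] by (intro exI[of _ "{#(m, r), (n, s)#} + A0"] exI[of _ Q]) (simp add: A)
qed

text \<open>Inverse of (C). Both removed arcs may join neighbouring rows, hence freeness is required
  twice.\<close>

lemma move_up_disjoint:
  assumes v: "valid x k N A Q" and mem: "free k A m n" "free k A r s" and less: "s < r" "r < n" "n < m"
  shows "\<exists>A' Q'. valid x k N A' Q' \<and> arc_move (A', Q') (A, Q)"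
proof -
  obtain A0 where A: "A = add_mset (m, n) (add_mset (r, s) A0)"
    using split_two[of "(m, n)" A "(r, s)"] mem less by (auto simp: free_def)
  have pos: "1 \<le> n" "1 \<le> s" using valid_arc[OF v] by (auto simp: A)
  have forced: "k n \<le> count A0 (m, n)" if "m = Suc n"
    using mem(1) less that by (simp add: free_def A split: if_splits)
  have forced2: "k s \<le> count A0 (r, s)" if "r = Suc s"
    using mem(2) less that by (simp add: free_def A split: if_splits)
  have "valid x k N ({#(m, r), (n, s)#} + A0) Q"
  proof (rule valid_exchange)
    show "valid x k N ({#(m, n), (r, s)#} + A0) Q" using v by (simp add: A)
    show "\<forall>(m, r)\<in>#{#(m, r), (n, s)#}. 1 \<le> r \<and> r < m" using pos less by simp
    show "k i \<le> count A0 (Suc i, i)" if "(Suc i, i) \<in># {#(m, n), (r, s)#}" for i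
      using that less forced forced2 by auto
  qed (simp_all add: add_mset_commute)
  then show ?thesis
    using arc_move_C[OF less, of A0 Q] by (intro exI[of _ "{#(m, r), (n, s)#} + A0"] exI[of _ Q]) (simp add: A)
qed

lemma move_down_covered_pole:
  assumes v: "valid x k N A Q" and mem: "(m, s) \<in># A" "r \<in># Q" and less: "s < r" "r < m"
  shows "\<exists>A' Q'. valid x k N A' Q' \<and> arc_move (A, Q) (A', Q') \<and> image_mset fst A' = image_mset fst A"
proof -
  obtain A0 Q0 where A: "A = add_mset (m, s) A0" and Q: "Q = add_mset r Q0"
    using mem by (meson multi_member_split free_def)
  have pos: "1 \<le> s" "s < m" using valid_arc[OF v] by (auto simp: A)
  have "valid x k N ({#(m, r)#} + A0) (add_mset s Q0)"
  proof (rule valid_exchange)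
    show "valid x k N ({#(m, s)#} + A0) (add_mset r Q0)" using v by (simp add: A Q)
    show "\<forall>(m, r)\<in>#{#(m, r)#}. 1 \<le> r \<and> r < m" using pos less by simp
    show "k i \<le> count A0 (Suc i, i)" if "(Suc i, i) \<in># {#(m, s)#}" for i
      using that less by auto
  qed (simp_all add: add_mset_commute)
  then show ?thesis
    using arc_move_B[OF less, of A0 Q0]
    by (intro exI[of _ "{#(m, r)#} + A0"] exI[of _ "add_mset s Q0"]) (simp add: A Q)
qed

text \<open>The pole becomes the end of an arc, and ends must be positive. \<open>valid\<close> does
  not by itself exclude poles at 0, hence \<open>1 \<le> s\<close>.\<close>

lemma move_up_left_pole:
  assumes v: "valid x k N A Q" and mem: "free k A m r" "s \<in># Q" and less: "1 \<le> s" "s < r"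
  shows "\<exists>A' Q'. valid x k N A' Q' \<and> arc_move (A', Q') (A, Q) \<and> image_mset fst A' = image_mset fst A"
proof -
  obtain A0 Q0 where A: "A = add_mset (m, r) A0" and Q: "Q = add_mset s Q0"
    using mem by (meson multi_member_split free_def)
  have pos: "1 \<le> r" "r < m" using valid_arc[OF v] by (auto simp: A)
  have forced: "k r \<le> count A0 (m, r)" if "m = Suc r"
    using mem(1) less that by (simp add: free_def A split: if_splits)
  have "valid x k N ({#(m, s)#} + A0) (add_mset r Q0)"
  proof (rule valid_exchange)
    show "valid x k N ({#(m, r)#} + A0) (add_mset s Q0)" using v by (simp add: A Q)
    show "\<forall>(m, r)\<in>#{#(m, s)#}. 1 \<le> r \<and> r < m" using pos less by simp
    show "k i \<le> count A0 (Suc i, i)" if "(Suc i, i) \<in># {#(m, r)#}" for i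
      using that less forced by auto
  qed (simp_all add: add_mset_commute)
  then show ?thesis
    using arc_move_B[OF less(2) pos(2), of A0 Q0]
    by (intro exI[of _ "{#(m, s)#} + A0"] exI[of _ "add_mset r Q0"]) (simp add: A Q)
qed

lemma move_up_right_pole:
  assumes v: "valid x k N A Q" and mem: "free k A r s" "m \<in># Q" and less: "r < m"
  shows "\<exists>A' Q'. valid x k N A' Q' \<and> arc_move (A', Q') (A, Q)"
proof -
  obtain A0 Q0 where A: "A = add_mset (r, s) A0" and Q: "Q = add_mset m Q0"
    using mem by (meson multi_member_split free_def)
  have pos: "1 \<le> s" "s < r" using valid_arc[OF v] by (auto simp: A)
  have forced: "k s \<le> count A0 (r, s)" if "r = Suc s"
    using mem(1) less that by (simp add: free_def A split: if_splits)
  have "valid x k N ({#(m, s)#} + A0) (add_mset r Q0)"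
  proof (rule valid_exchange)
    show "valid x k N ({#(r, s)#} + A0) (add_mset m Q0)" using v by (simp add: A Q)
    show "\<forall>(m, r)\<in>#{#(m, s)#}. 1 \<le> r \<and> r < m" using pos less by simp
    show "k i \<le> count A0 (Suc i, i)" if "(Suc i, i) \<in># {#(r, s)#}" for i
      using that less forced by auto
  qed (simp_all add: add_mset_commute)
  then show ?thesis
    using arc_move_D[OF pos(2) less, of A0 Q0]
    by (intro exI[of _ "{#(m, s)#} + A0"] exI[of _ "add_mset r Q0"]) (simp add: A Q)
qed

section \<open>Which of two valid diagrams admits an inverse move\<close>

lemma exists_larger_count:
  assumes "size R = size R'" "count R r < count R' r"
  shows "\<exists>s. count R' s < count R s"
proof (rule ccontr)
  assume "\<not> ?thesis"
  then have "R \<subseteq># R'" by (auto intro!: mset_subset_eqI simp: not_less)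
  moreover have "R \<noteq> R'" using assms(2) by auto
  ultimately have "R \<subset># R'" by simp
  then show False using mset_subset_size assms(1) by fastforce
qed

lemma sum_count_column:
  assumes "finite F"
  shows "(\<Sum>m\<in>F. count A (m, r)) = count (image_mset snd (filter_mset (\<lambda>e. fst e \<in> F) A)) r"
proof (induction A)
  case (add e A)
  obtain m r' where e: "e = (m, r')" by (cases e)
  have "(\<Sum>m'\<in>F. count (add_mset e A) (m', r)) = (\<Sum>m'\<in>F. count A (m', r)) + (\<Sum>m'\<in>F. if m = m' then of_bool (r' = r) else 0)"
    unfolding sum.distrib[symmetric] by (rule sum.cong) (auto simp: e)
  then show ?case using add assms by (simp add: e)
qed simp

lemma sum_count_column_le:
  assumes "finite F"
  shows "(\<Sum>m\<in>F. count A (m, r)) \<le> count (image_mset snd A) r"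
  unfolding sum_count_column[OF assms]
  by (intro mset_subset_eq_count image_mset_subseteq_mono multiset_filter_subset)

lemma sum_count_column_eq:
  assumes "finite F" "\<And>m. (m, r) \<in># A \<Longrightarrow> m \<in> F"
  shows "(\<Sum>m\<in>F. count A (m, r)) = count (image_mset snd A) r"
proof -
  have "count (image_mset snd (filter_mset (\<lambda>e. fst e \<in> F) A)) r = count (image_mset snd A) r"
    using assms(2) by (induction A) auto
  then show ?thesis by (simp only: sum_count_column[OF assms(1)])
qed

text \<open>Row \<open>m\<close> has equally many arcs in both diagrams, so \<open>A\<close> makes
  up for its missing arcs to \<open>r\<close> by an extra arc to some \<open>s > r\<close>. As the
  degrees at \<open>r\<close> agree, \<open>A\<close> also has a pole at \<open>r\<close> or an arc
  ending there that starts after row \<open>m\<close>. An inverse (B) or (A) then redirects the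
  extra arc from \<open>s\<close> to \<open>r\<close>.\<close>

lemma same_starts_move_up:
  assumes v: "valid x k N A Q" and v': "valid x k N A' Q'"
    and starts: "image_mset fst A = image_mset fst A'"
    and rows: "\<And>m' r'. m' < m \<Longrightarrow> count A (m', r') = count A' (m', r')"
    and left: "\<And>r'. r' < r \<Longrightarrow> count A (m, r') = count A' (m, r')"
    and less: "count A (m, r) < count A' (m, r)"
  shows "\<exists>A'' Q''. valid x k N A'' Q'' \<and> arc_move (A'', Q'') (A, Q) \<and> image_mset fst A'' = image_mset fst A"
proof -
  have "(m, r) \<in># A'" using less by (metis count_greater_zero_iff less_nat_zero_code neq0_conv)
  then have r: "1 \<le> r" using valid_arc[OF v'] by blast
  have "\<exists>s. count (mset (row_list A' m)) s < count (mset (row_list A m)) s"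
    using less starts by (intro exists_larger_count[of _ _ r]) (simp_all only: size_mset length_row_list count_row_list)
  then obtain s where s: "count A' (m, s) < count A (m, s)"
    by (auto simp only: count_row_list)
  then have mem: "(m, s) \<in># A" by (metis count_greater_zero_iff less_nat_zero_code neq0_conv)
  have "r < s" using s left[of s] less by (cases s r rule: linorder_cases) auto
  \<comment> \<open>\<open>A\<close> has more arcs from \<open>m\<close> to \<open>s\<close> than
    \<open>A'\<close>, which already has the forced ones.\<close>
  have free: "free k A m s"
    using mem s valid_forced[OF v', of s] by (auto simp: free_def)
  show ?thesis
  proof (cases "r \<in># Q")
    case True
    show ?thesis by (rule move_up_left_pole[OF v free True r \<open>r < s\<close>])
  next
    case False
    \<comment> \<open>Otherwise all arcs of \<open>A\<close> ending at \<open>r\<close> start in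
      rows up to \<open>m\<close>, where \<open>A\<close> has fewer of them than \<open>A'\<close>;
      without a pole at \<open>r\<close> the degree would be too small.\<close>
    have "\<exists>m'. (m', r) \<in># A \<and> m < m'"
    proof (rule ccontr)
      assume "\<not> ?thesis"
      then have "count (image_mset snd A) r = (\<Sum>m'\<in>{..m}. count A (m', r))"
        by (intro sum_count_column_eq[symmetric]) (auto simp: not_less)
      also have "\<dots> < (\<Sum>m'\<in>{..m}. count A' (m', r))"
      proof (rule sum_strict_mono_ex1)
        show "\<forall>m'\<in>{..m}. count A (m', r) \<le> count A' (m', r)"
          using rows less by (auto simp: le_less)
        show "\<exists>m'\<in>{..m}. count A (m', r) < count A' (m', r)"
          using less by auto
      qed simp
      also have "\<dots> \<le> count (image_mset snd A') r"
        by (rule sum_count_column_le) simp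
      finally have "count (image_mset snd A) r < count (image_mset snd A') r" .
      moreover have "count Q r = 0" using False by (simp add: not_in_iff)
      ultimately show False
        using valid_degree[OF v, of r] valid_degree[OF v', of r] starts by simp
    qed
    then obtain m' where "(m', r) \<in># A" "m < m'" by blast
    then show ?thesis
      using move_up_nested[OF v _ free \<open>r < s\<close>] valid_arc[OF v mem] by blast
  qed
qed

lemma same_starts_move_up_either:
  assumes v: "valid x k N A Q" and v': "valid x k N A' Q'"
    and starts: "image_mset fst A = image_mset fst A'" and "A \<noteq> A'"
  shows "(\<exists>A'' Q''. valid x k N A'' Q'' \<and> arc_move (A'', Q'') (A, Q) \<and> image_mset fst A'' = image_mset fst A)
    \<or> (\<exists>A'' Q''. valid x k N A'' Q'' \<and> arc_move (A'', Q'') (A', Q') \<and> image_mset fst A'' = image_mset fst A')"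
proof -
  have ex: "\<exists>m r. count A (m, r) \<noteq> count A' (m, r)"
    using \<open>A \<noteq> A'\<close> by (auto simp: multiset_eq_iff)
  define m where "m = (LEAST m. \<exists>r. count A (m, r) \<noteq> count A' (m, r))"
  have m: "\<exists>r. count A (m, r) \<noteq> count A' (m, r)"
    unfolding m_def by (rule LeastI_ex[OF ex])
  have rows: "count A (m', r) = count A' (m', r)" if "m' < m" for m' r
    using not_less_Least[OF that[unfolded m_def]] by blast
  define r where "r = (LEAST r. count A (m, r) \<noteq> count A' (m, r))"
  have r: "count A (m, r) \<noteq> count A' (m, r)"
    unfolding r_def by (rule LeastI_ex[OF m])
  have left: "count A (m, r') = count A' (m, r')" if "r' < r" for r'
    using not_less_Least[OF that[unfolded r_def]] by blast
  from r consider "count A (m, r) < count A' (m, r)" | "count A' (m, r) < count A (m, r)"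
    by linarith
  then show ?thesis
  proof cases
    case 1
    show ?thesis
      by (rule disjI1, rule same_starts_move_up[OF v v' starts rows left 1])
  next
    case 2
    show ?thesis
      by (rule disjI2, rule same_starts_move_up[OF v' v starts[symmetric] rows[symmetric] left[symmetric] 2])
  qed
qed

lemma count_image_single:
  assumes "\<And>e. e \<in># A \<Longrightarrow> f e = f d \<Longrightarrow> e = d"
  shows "count (image_mset f A) (f d) = count A d"
  using assms by (induction A) auto

text \<open>A 2 has to be moved from a row \<open>n\<close> with too many into row \<open>m\<close>.
  Since the counts agree after \<open>m\<close>, such a row satisfies \<open>n < m\<close>. A free
  arc starting at \<open>n\<close> is lengthened to start at \<open>m\<close>: by an inverse (D) if
  there is a pole at \<open>m\<close>, otherwise by an inverse (C) using a free arc that ends at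
  \<open>m\<close>.\<close>

lemma diff_starts_move_up:
  assumes v: "valid x k N A Q" and v': "valid x k N A' Q'"
    and above: "\<And>i. m < i \<Longrightarrow> count (image_mset fst A) i = count (image_mset fst A') i"
    and less: "count (image_mset fst A) m < count (image_mset fst A') m"
  shows "\<exists>A'' Q''. valid x k N A'' Q'' \<and> arc_move (A'', Q'') (A, Q)"
proof -
  have "\<exists>n. count (image_mset fst A') n < count (image_mset fst A) n"
    by (rule exists_larger_count[OF _ less]) (simp add: valid_size[OF v] valid_size[OF v'])
  then obtain n where n: "count (image_mset fst A') n < count (image_mset fst A) n" by blast
  then have "n < m" using above[of n] less by (cases n m rule: linorder_cases) auto
  \<comment> \<open>If no arc from \<open>n\<close> is free, all of them go to \<open>n - 1\<close>
    and none exceeds the forced number; but \<open>A'\<close> has at least that many starts at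
    \<open>n\<close>, and fewer than \<open>A\<close>.\<close>
  have "\<exists>s. free k A n s"
  proof (rule ccontr)
    assume "\<not> ?thesis"
    then have *: "n = Suc s \<and> count A (n, s) \<le> k s" if "(n, s) \<in># A" for s
      using that by (auto simp: free_def)
    have "n \<in># image_mset fst A"
      using n by (metis count_greater_zero_iff less_nat_zero_code neq0_conv)
    then obtain s where s: "(n, s) \<in># A" by auto
    have "count (image_mset fst A) (fst (n, s)) = count A (n, s)"
    proof (rule count_image_single)
      fix e assume "e \<in># A" "fst e = fst (n, s)"
      then have "n = Suc (snd e)" "e = (n, snd e)" using *[of "snd e"] by (auto simp: prod_eq_iff)
      then show "e = (n, s)" using *[OF s] by simp
    qed
    then have "count (image_mset fst A) n \<le> k s" using *[OF s] by auto
    moreover have "k s \<le> count (image_mset fst A') n"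
      using valid_forced[OF v', of s] count_le_count_image[of A' "(Suc s, s)" fst] *[OF s] by simp
    ultimately show False using n by simp
  qed
  then obtain s where s: "free k A n s" by blast
  then have "s < n" using valid_arc[OF v] by (auto simp: free_def)
  show ?thesis
  proof (cases "m \<in># Q")
    case True
    show ?thesis by (rule move_up_right_pole[OF v s True \<open>n < m\<close>])
  next
    case False
    \<comment> \<open>With fewer starts and no pole at \<open>m\<close>, equal degrees give
      \<open>A\<close> more ends at \<open>m\<close> than \<open>A'\<close>, hence more than
      \<open>k m\<close>.\<close>
    have "\<exists>q. free k A q m"
    proof (rule ccontr)
      assume "\<not> ?thesis"
      then have *: "q = Suc m \<and> count A (q, m) \<le> k m" if "(q, m) \<in># A" for q
        using that by (auto simp: free_def)
      have "count (image_mset snd A) (snd (Suc m, m)) = count A (Suc m, m)"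
        by (rule count_image_single) (use * in force)
      then have "count (image_mset snd A) m \<le> k m"
        using *[of "Suc m"] by (cases "(Suc m, m) \<in># A") (auto simp: not_in_iff)
      moreover have "k m \<le> count (image_mset snd A') m"
        using valid_forced[OF v', of m] count_le_count_image[of A' "(Suc m, m)" snd] by simp
      moreover have "count Q m = 0" using False by (simp add: not_in_iff)
      ultimately show False
        using valid_degree[OF v, of m] valid_degree[OF v', of m] less by linarith
    qed
    then obtain q where q: "free k A q m" by blast
    then have "m < q" using valid_arc[OF v] by (auto simp: free_def)
    show ?thesis by (rule move_up_disjoint[OF v q s \<open>s < n\<close> \<open>n < m\<close> \<open>m < q\<close>])
  qed
qed

lemma diff_starts_move_up_either:
  assumes v: "valid x k N A Q" and v': "valid x k N A' Q'"
    and "image_mset fst A \<noteq> image_mset fst A'"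
  shows "(\<exists>A'' Q''. valid x k N A'' Q'' \<and> arc_move (A'', Q'') (A, Q))
    \<or> (\<exists>A'' Q''. valid x k N A'' Q'' \<and> arc_move (A'', Q'') (A', Q'))"
proof -
  define S where "S = {i. count (image_mset fst A) i \<noteq> count (image_mset fst A') i}"
  have "S \<subseteq> set_mset (image_mset fst A) \<union> set_mset (image_mset fst A')"
  proof
    fix i assume "i \<in> S"
    then have "0 < count (image_mset fst A) i \<or> 0 < count (image_mset fst A') i"
      unfolding S_def mem_Collect_eq by linarith
    then show "i \<in> set_mset (image_mset fst A) \<union> set_mset (image_mset fst A')"
      unfolding count_greater_zero_iff by blast
  qed
  then have fin: "finite S" by (rule finite_subset) simp
  have "S \<noteq> {}" using assms(3) unfolding S_def multiset_eq_iff by blast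
  then have m: "Max S \<in> S" using fin by simp
  have above: "count (image_mset fst A) i = count (image_mset fst A') i" if "Max S < i" for i
    using that Max_ge[OF fin, of i] unfolding S_def mem_Collect_eq by linarith
  from m consider "count (image_mset fst A) (Max S) < count (image_mset fst A') (Max S)"
    | "count (image_mset fst A') (Max S) < count (image_mset fst A) (Max S)"
    unfolding S_def mem_Collect_eq by linarith
  then show ?thesis
  proof cases
    case 1
    show ?thesis by (rule disjI1, rule diff_starts_move_up[OF v v' above 1])
  next
    case 2
    show ?thesis by (rule disjI2, rule diff_starts_move_up[OF v' v above[symmetric] 2])
  qed
qed

section \<open>Extremal Klein tableaux\<close>

text \<open>A matching of 2's with 1's in higher rows. The admissible rows for a 2 in row
  \<open>i\<close> are all rows before \<open>i\<close>, so these sets are nested, and the prefix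
  inequalities suffice to choose the arcs one at a time without revising earlier choices.\<close>

lemma exists_arcs:
  fixes t ones k :: "nat \<Rightarrow> nat"
  assumes "t 0 = 0" and forced: "\<And>m. k m \<le> t (Suc m)" "\<And>m. k m \<le> ones m"
    and sums: "\<And>m. 0 < t m \<Longrightarrow> (\<Sum>i\<in>{..m}. t i) \<le> (\<Sum>i\<in>{..<m}. ones i)"
  shows "\<exists>A. (\<forall>(i, r)\<in>#A. r < i \<and> i \<le> m) \<and> (\<forall>i\<le>m. count (image_mset fst A) i = t i) \<and>
    (\<forall>r. count (image_mset snd A) r \<le> ones r) \<and> (\<forall>i<m. k i \<le> count A (Suc i, i))"
proof (induction m)
  case 0
  then show ?case using \<open>t 0 = 0\<close> by (intro exI[of _ "{#}"]) simp
next
  case (Suc m)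
  then obtain A where A: "\<forall>(i, r)\<in>#A. r < i \<and> i \<le> m" "\<forall>i\<le>m. count (image_mset fst A) i = t i"
    "\<forall>r. count (image_mset snd A) r \<le> ones r" "\<forall>i<m. k i \<le> count A (Suc i, i)" by blast
  \<comment> \<open>\<open>d\<close> counts the arcs built so far from row \<open>m + 1\<close>; it
    begins at \<open>k m\<close> so that the forced arcs are placed before any free choice.\<close>
  have "d \<le> t (Suc m) \<longrightarrow> (\<exists>A. (\<forall>(i, r)\<in>#A. r < i \<and> i \<le> Suc m) \<and>
    (\<forall>i\<le>m. count (image_mset fst A) i = t i) \<and> count (image_mset fst A) (Suc m) = d \<and>
    (\<forall>r. count (image_mset snd A) r \<le> ones r) \<and> (\<forall>i<Suc m. k i \<le> count A (Suc i, i)))"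
    if "k m \<le> d" for d
    using that
  proof (induction d rule: nat_induct_at_least)
    case base
    \<comment> \<open>Arcs from rows up to \<open>m\<close> end before \<open>m\<close>, so the 1's
      of row \<open>m\<close> are still all available for the forced arcs.\<close>
    have "count (image_mset fst A) (Suc m) = 0" "count (image_mset snd A) m = 0"
      using A(1) unfolding count_eq_zero_iff by fastforce+
    then show ?case
      using A forced(2)[of m]
      by (intro impI exI[of _ "A + replicate_mset (k m) (Suc m, m)"])
        (auto simp: less_Suc_eq split: if_splits)
  next
    case (Suc d)
    show ?case
    proof
      assume d: "Suc d \<le> t (Suc m)"
      then obtain A where A: "\<forall>(i, r)\<in>#A. r < i \<and> i \<le> Suc m"
        "\<forall>i\<le>m. count (image_mset fst A) i = t i" "count (image_mset fst A) (Suc m) = d"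
        "\<forall>r. count (image_mset snd A) r \<le> ones r" "\<forall>i<Suc m. k i \<le> count A (Suc i, i)"
        using Suc.IH by auto
      \<comment> \<open>If all 1's in rows up to \<open>m\<close> were used, there would be at least
        as many arcs as such 1's, hence at least as many as 2's in rows up to \<open>m + 1\<close>;
        but one of these 2's is still unmatched.\<close>
      have "\<exists>r<Suc m. count (image_mset snd A) r < ones r"
      proof (rule ccontr)
        assume "\<not> ?thesis"
        then have "(\<Sum>r\<in>{..<Suc m}. ones r) \<le> (\<Sum>r\<in>{..<Suc m}. count (image_mset snd A) r)"
          by (intro sum_mono) (meson lessThan_iff not_less)
        also have "\<dots> \<le> size A"
          using size_filter_eq_sum_count[of "{..<Suc m}" snd A] size_filter_mset_lesseq[of _ A] by (metis finite_lessThan)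
        also have "size A = size (filter_mset (\<lambda>e. fst e \<in> {..Suc m}) A)"
        proof -
          have "filter_mset (\<lambda>e. fst e \<in> {..Suc m}) A = A"
            unfolding filter_mset_eq_conv using A(1) by auto
          then show ?thesis by simp
        qed
        also have "\<dots> = (\<Sum>i\<in>{..Suc m}. count (image_mset fst A) i)"
          by (rule size_filter_eq_sum_count) simp
        also have "\<dots> = (\<Sum>i\<in>{..m}. t i) + d" using A(2,3) by simp
        also have "\<dots> < (\<Sum>i\<in>{..Suc m}. t i)" using d by simp
        also have "\<dots> \<le> (\<Sum>r\<in>{..<Suc m}. ones r)" by (rule sums) (use d in simp)
        finally show False by simp
      qed
      then obtain r where r: "r < Suc m" "count (image_mset snd A) r < ones r" by blast
      show "\<exists>A. (\<forall>(i, r)\<in>#A. r < i \<and> i \<le> Suc m) \<and>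
        (\<forall>i\<le>m. count (image_mset fst A) i = t i) \<and> count (image_mset fst A) (Suc m) = Suc d \<and>
        (\<forall>r. count (image_mset snd A) r \<le> ones r) \<and> (\<forall>i<Suc m. k i \<le> count A (Suc i, i))"
        using A r by (intro exI[of _ "add_mset (Suc m, r) A"]) (auto simp: Suc_le_eq le_SucI)
    qed
  qed
  from this[OF forced(1)] obtain A where A: "\<forall>(i, r)\<in>#A. r < i \<and> i \<le> Suc m"
    "\<forall>i\<le>m. count (image_mset fst A) i = t i" "count (image_mset fst A) (Suc m) = t (Suc m)"
    "\<forall>r. count (image_mset snd A) r \<le> ones r" "\<forall>i<Suc m. k i \<le> count A (Suc i, i)"
    by blast
  then show ?case by (intro exI[of _ A]) (auto simp: le_Suc_eq)
qed

text \<open>The lattice condition is used for the columns from the leftmost 2 of row \<open>m\<close> on.\<close>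

lemma lr_tableau_row_sums:
  assumes "is_partition b" "is_partition g" "lr_tableau a b g T" "0 < twos b g T m"
  shows "(\<Sum>i\<in>{..m}. twos b g T i) \<le> (\<Sum>i\<in>{..<m}. ones_in_row b g T i)"
proof -
  define c where "c = conj b m - twos b g T m"
  have "{j. (m, j) \<in> skew b g \<and> T m j = 2} \<noteq> {}" using assms(4) by (metis card.empty less_irrefl)
  then have m: "1 \<le> m" "conj g m < conj b m" using skew_iff[OF assms(1,2)] by auto
  have "twos b g T m \<le> conj b m - conj g m"
    using ones_plus_twos[OF assms(3), of m] row_size_eq[OF assms(1,2) m(1)] by linarith
  then have c: "conj g m \<le> c" "c < conj b m" using m assms(4) unfolding c_def by linarith+
  have two: "T m j = 2 \<longleftrightarrow> c < j" if "(m, j) \<in> skew b g" for j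
    using lr_tableau_two_iff[OF assms(1-3) that] by (simp add: c_def)
  \<comment> \<open>A column up to \<open>c\<close> that has a box above row \<open>m\<close>
    reaches down to row \<open>m\<close>, since row \<open>m\<close> extends beyond
    \<open>c\<close>. A 2 there would have a box below it, which strict increase forbids.\<close>
  have right: "c < j" if s: "(i, j) \<in> skew b g" "i \<le> m" "T i j = 2" for i j
  proof (cases "i = m")
    case True
    then show ?thesis using two s by blast
  next
    case False
    then have i: "Suc i \<le> m" using s by simp
    show ?thesis
    proof (rule ccontr)
      assume "\<not> c < j"
      then have "(Suc i, j) \<in> skew b g"
        using s c conj_antimono[OF i, of b] conj_antimono[of i "Suc i" g] by (auto simp: skew_iff[OF assms(1,2)])
      then show False using lr_tableau_col(1)[OF assms(3) s(1), of "Suc i"] s(3) by simp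
    qed
  qed
  \<comment> \<open>To the right of \<open>c\<close>, row \<open>m\<close> holds only 2's, and any
    lower box lies under a box of row \<open>m\<close> and is therefore a 2.\<close>
  have above: "i < m" if s: "(i, j) \<in> skew b g" "c < j" "T i j = 1" for i j
  proof (rule ccontr)
    assume "\<not> i < m"
    then have i: "m \<le> i" by simp
    have s': "(m, j) \<in> skew b g"
      using s c m conj_antimono[OF i, of b] by (auto simp: skew_iff[OF assms(1,2)])
    then show False
      using lr_tableau_col(2)[OF assms(3) s' s(1)] two[OF s'] s i by (cases "m = i") auto
  qed
  have "card {(i, j). (i, j) \<in> skew b g \<and> i \<in> {..m} \<and> T i j = 2}
      \<le> card {(i, j). (i, j) \<in> skew b g \<and> c < j \<and> T i j = 2}"
    by (rule card_mono) (use right in auto)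
  also have "\<dots> \<le> card {(i, j). (i, j) \<in> skew b g \<and> c < j \<and> T i j = 1}"
    by (rule lr_tableau_lattice[OF assms(3)])
  also have "\<dots> \<le> card {(i, j). (i, j) \<in> skew b g \<and> i \<in> {..<m} \<and> T i j = 1}"
    by (rule card_mono) (use above in auto)
  finally show ?thesis
    by (simp only: card_row_sum finite_atMost finite_lessThan ones_in_row_def)
qed

lemma lr_tableau_refined:
  assumes "is_partition b" "is_partition g" "lr_tableau a b g T"
  shows "\<exists>P. klein a b g P \<and> forget P = T"
proof -
  let ?t = "twos b g T" and ?o = "ones_in_row b g T" and ?M = "sum_list b"
  have t0: "?t 0 = 0" "?o 0 = 0" by (simp_all add: skew_def ones_in_row_def)
  have forced: "overlap b g m \<le> ?t (Suc m)" "overlap b g m \<le> ?o m" for m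
    unfolding overlap_def ones_in_row_def
    by (rule card_mono; use lr_tableau_col[OF assms(3)] in auto)+
  obtain A where A: "\<forall>(i, r)\<in>#A. r < i \<and> i \<le> ?M" "\<forall>i\<le>?M. count (image_mset fst A) i = ?t i"
    "\<forall>r. count (image_mset snd A) r \<le> ?o r" "\<forall>i<?M. overlap b g i \<le> count A (Suc i, i)"
    using exists_arcs[of ?t "overlap b g" ?o ?M, OF t0(1) forced lr_tableau_row_sums[OF assms]] by blast
  have t_out: "?t i = 0" if "?M < i" for i
    using that skew_bounds(2)[of i _ b g] by auto
  have starts: "count (image_mset fst A) i = ?t i" for i
  proof (cases "i \<le> ?M")
    case False
    then have "i \<notin># image_mset fst A" using A(1) by auto
    then have "count (image_mset fst A) i = 0" by (simp only: not_in_iff)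
    then show ?thesis using t_out[of i] False by linarith
  qed (use A(2) in simp)
  define Q where "Q = image_mset fst (mset_set {(i, j). (i, j) \<in> skew b g \<and> T i j = 1}) - image_mset snd A"
  have Q: "count Q i = ?o i - count (image_mset snd A) i" for i
    unfolding Q_def count_diff count_fst_skew[where R = "\<lambda>i j. T i j = 1"] ones_in_row_def ..
  have "valid (row_size b g) (overlap b g) (conj a 2) A Q"
    unfolding valid_def
  proof (intro conjI allI impI)
    fix m r assume mr: "(m, r) \<in># A"
    then show "r < m" using A(1) by auto
    have "0 < count (image_mset snd A) r" using mr by (force simp: count_greater_zero_iff)
    \<comment> \<open>Row 0 has no boxes, so the bound on ends by the number of 1's also rules out
      the end 0.\<close>
    then have "0 < ?o r" using A(3) by (meson less_le_trans)
    then show "1 \<le> r" using t0(2) by (cases r) auto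
  next
    fix i
    show "count (image_mset fst A) i + count (image_mset snd A) i + count Q i = row_size b g i"
      using ones_plus_twos[OF assms(3), of i] A(3)[rule_format, of i] starts[of i] Q[of i] by linarith
    show "overlap b g i \<le> count A (Suc i, i)"
      using A(4) forced(1)[of i] t_out[of "Suc i"] by (cases "i < ?M") auto
  next
    have "filter_mset (\<lambda>e. fst e \<in> {..?M}) A = A"
      unfolding filter_mset_eq_conv using A(1) by auto
    then have "size A = (\<Sum>i\<in>{..?M}. count (image_mset fst A) i)"
      using size_filter_eq_sum_count[of "{..?M}" fst A] by simp
    also have "\<dots> = card {(i, j). (i, j) \<in> skew b g \<and> i \<in> {..?M} \<and> T i j = 2}"
      by (simp only: card_row_sum finite_atMost starts)
    also have "{(i, j). (i, j) \<in> skew b g \<and> i \<in> {..?M} \<and> T i j = 2} = {(i, j). (i, j) \<in> skew b g \<and> T i j = 2}"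
      using skew_bounds(2) by fastforce
    also have "card \<dots> = conj a 2"
      using assms(3) unfolding lr_tableau_def by blast
    finally show "size A = conj a 2" .
  qed
  then have P: "klein a b g (tab b g A)" "arcs b g (tab b g A) = A"
    using tab_klein[OF assms] by (auto simp: arc_diagram_def)
  have "forget (tab b g A) = T"
  proof (rule lr_tableau_eqI[OF assms(1,2) klein_lr_tableau[OF P(1)] assms(3)])
    show "twos b g (forget (tab b g A)) i = twos b g T i" for i
      by (simp only: count_fst_eq_card[symmetric] P(2) starts)
  qed
  then show ?thesis using P(1) by blast
qed

section \<open>Existence of extremal elements through the potential\<close>

lemma klein_arc_starts_bounded:
  "\<forall>(m, r)\<in>#fst (arc_diagram b g P). m < Suc (sum_list b)"
  using skew_bounds(2) by (fastforce simp: arc_diagram_def arcs_def)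

lemma arc_diagram_eqI:
  assumes "is_partition b" "is_partition g" "klein a b g P" "klein a b g P'"
    and "arc_diagram b g P = arc_diagram b g P'"
  shows "P = P'"
  by (rule klein_eqI[OF assms(1-4)]) (use assms(5) in \<open>simp add: arc_diagram_def\<close>)

abbreviation klein_potential :: "nat list \<Rightarrow> nat list \<Rightarrow> (nat \<Rightarrow> nat \<Rightarrow> kentry) \<Rightarrow> nat" where
  "klein_potential b g P \<equiv> potential (Suc (sum_list b)) (arc_diagram b g P)"

lemma arc_le_potential:
  assumes "is_partition b" "is_partition g" "arc_le a b g P P'"
  shows "P = P' \<or> klein_potential b g P < klein_potential b g P'"
proof -
  have le: "klein a b g P" "klein a b g P'" "arc_move\<^sup>*\<^sup>* (arc_diagram b g P') (arc_diagram b g P)"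
    using assms(3) unfolding arc_le_def by blast+
  from arc_moves_potential[OF le(3) klein_arc_starts_bounded] show ?thesis
    using arc_diagram_eqI[OF assms(1,2) le(1,2)] by blast
qed

lemma sum_mset_le_size:
  fixes f :: "'a \<Rightarrow> nat"
  assumes "\<And>e. e \<in># M \<Longrightarrow> f e \<le> C"
  shows "(\<Sum>e\<in>#M. f e) \<le> size M * C"
  using assms by (induction M) (auto simp: add_mono)

text \<open>Maximal elements are found by maximising the potential, which needs an upper bound
  rather than finiteness of the set of tableaux. \<open>C\<close> bounds the share of one arc and
  \<open>S\<close> is the sum of the row numbers of all boxes.\<close>

lemma klein_potential_bounded:
  "\<exists>B. \<forall>P. klein a b g P \<longrightarrow> klein_potential b g P \<le> B"
proof -
  define K where "K = Suc (sum_list b)"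
  define C where "C = K * K + Suc K * K"
  define S where "S = \<Sum>\<^sub># (image_mset fst (mset_set (skew b g)))"
  have "potential K (arc_diagram b g P) \<le> conj a 2 * C + K * S" if P: "klein a b g P" for P
  proof -
    have "(\<Sum>(m, r)\<in>#arcs b g P. m * r + Suc K * m) \<le> size (arcs b g P) * C"
    proof (rule sum_mset_le_size)
      fix e assume e: "e \<in># arcs b g P"
      obtain m r where mr: "e = (m, r)" by (cases e)
      have "m < K" using e klein_arc_starts_bounded[of b g P] by (auto simp: mr K_def arc_diagram_def)
      moreover have "r < m" using valid_arc[OF klein_valid[OF P]] e mr by blast
      ultimately have "m * r + Suc K * m \<le> C"
        unfolding C_def by (intro add_mono mult_le_mono) auto
      then show "(case e of (m, r) \<Rightarrow> m * r + Suc K * m) \<le> C" by (simp only: mr prod.case)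
    qed
    moreover have "\<Sum>\<^sub># (poles b g P) \<le> S"
    proof -
      have "poles b g P \<subseteq># image_mset fst (mset_set {(i, j). (i, j) \<in> skew b g \<and> P i j = K1})"
        unfolding poles_def by (rule diff_subset_eq_self)
      also have "\<dots> \<subseteq># image_mset fst (mset_set (skew b g))"
        by (intro image_mset_subseteq_mono) (auto simp: finite_skew intro: subset_imp_msubset_mset_set)
      finally obtain R where "image_mset fst (mset_set (skew b g)) = poles b g P + R"
        unfolding subset_mset.le_iff_add by blast
      then show ?thesis by (simp add: S_def)
    qed
    ultimately show ?thesis
      unfolding potential_def arc_diagram_def fst_conv snd_conv valid_size[OF klein_valid[OF P]]
      by (rule add_mono[OF _ mult_le_mono2])
  qed
  then show ?thesis unfolding K_def by blast
qed

lemma exists_minimal: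
  assumes "is_partition b" "is_partition g" "P \<in> S"
  shows "\<exists>P. minimal_in a b g S P"
proof -
  obtain P where "P \<in> S" "\<forall>P'\<in>S. klein_potential b g P \<le> klein_potential b g P'"
    using ex_has_least_nat[of "\<lambda>P. P \<in> S" P "klein_potential b g"] assms(3) by blast
  then show ?thesis
    using arc_le_potential[OF assms(1,2)] unfolding minimal_in_def by (metis linorder_not_less)
qed

lemma exists_maximal:
  assumes "is_partition b" "is_partition g" "P \<in> S" "\<And>P. P \<in> S \<Longrightarrow> klein a b g P"
  shows "\<exists>P. maximal_in a b g S P"
proof -
  obtain B where "\<forall>P. klein a b g P \<longrightarrow> klein_potential b g P \<le> B"
    using klein_potential_bounded by blast
  then have "\<forall>P. P \<in> S \<longrightarrow> klein_potential b g P < Suc B" using assms(4) by (simp add: less_Suc_eq_le)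
  from ex_has_greatest_nat[of "\<lambda>P. P \<in> S", OF assms(3) this] obtain P
    where "P \<in> S" "\<forall>P'\<in>S. klein_potential b g P' \<le> klein_potential b g P"
    by blast
  then show ?thesis
    using arc_le_potential[OF assms(1,2)] unfolding maximal_in_def by (metis linorder_not_less)
qed

section \<open>Extremal tableaux and the moves at their diagrams\<close>

text \<open>Carries a move between valid diagrams over to tableaux. The new tableau differs from
  \<open>P\<close> because a move strictly lowers the potential and so never fixes a
  diagram.\<close>

lemma realise_valid:
  assumes "is_partition b" "is_partition g" "klein a b g P"
    and "valid (row_size b g) (overlap b g) (conj a 2) A Q"
    and "arc_move (A, Q) (arc_diagram b g P) \<or> arc_move (arc_diagram b g P) (A, Q)"
  obtains P' where "klein a b g P'" "arc_diagram b g P' = (A, Q)" "P' \<noteq> P"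
proof -
  note P' = tab_klein[OF assms(1,2) klein_lr_tableau[OF assms(3)] assms(4)]
  have "tab b g A \<noteq> P"
  proof
    assume "tab b g A = P"
    then have "arc_move (arc_diagram b g P) (arc_diagram b g P)" using assms(5) P'(2) by simp
    then show False using arc_move_potential(1)[OF _ klein_arc_starts_bounded] by blast
  qed
  then show thesis using that P' by blast
qed

lemma move_down_refining:
  assumes "is_partition b" "is_partition g" "minimal_in a b g (klein_ref a b g T) P"
    and "valid (row_size b g) (overlap b g) (conj a 2) A Q" "arc_move (arc_diagram b g P) (A, Q)"
    and "image_mset fst A = image_mset fst (arcs b g P)"
  shows False
proof -
  have P: "klein a b g P" "forget P = T" using assms(3) by (auto simp: minimal_in_def klein_ref_def)
  obtain P' where P': "klein a b g P'" "arc_diagram b g P' = (A, Q)" "P' \<noteq> P"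
    using realise_valid[OF assms(1,2) P(1) assms(4)] assms(5) by blast
  have "forget P' = T"
    using forget_eq_iff[OF assms(1,2) P'(1) P(1)] P(2) P'(2) assms(6) by (simp add: arc_diagram_def)
  moreover have "arc_le a b g P' P"
    using P(1) P' assms(5) by (simp add: arc_le_def r_into_rtranclp)
  ultimately show False using assms(3) P' by (auto simp: minimal_in_def klein_ref_def)
qed

lemma minimal_no_crossing:
  assumes "is_partition b" "is_partition g" "minimal_in a b g (klein_ref a b g T) P"
    and "(m, r) \<in># arcs b g P" "(n, s) \<in># arcs b g P" "s < r" "r < n" "n < m"
  shows False
proof -
  have "klein a b g P" using assms(3) by (simp add: minimal_in_def klein_ref_def)
  from move_down_crossing[OF klein_valid[OF this] assms(4-8)] show False
    using move_down_refining[OF assms(1-3)] unfolding arc_diagram_def by blast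
qed

lemma minimal_no_covered_pole:
  assumes "is_partition b" "is_partition g" "minimal_in a b g (klein_ref a b g T) P"
    and "(m, s) \<in># arcs b g P" "r \<in># poles b g P" "s < r" "r < m"
  shows False
proof -
  have "klein a b g P" using assms(3) by (simp add: minimal_in_def klein_ref_def)
  from move_down_covered_pole[OF klein_valid[OF this] assms(4-7)] show False
    using move_down_refining[OF assms(1-3)] unfolding arc_diagram_def by blast
qed

text \<open>(C) needs crossing arcs just as (A) does, and (D) a covered pole just as (B) does; so a
  tableau to which neither (A) nor (B) applies admits no move leaving its LR-tableau either.\<close>

lemma minimal_refining_no_move:
  assumes "is_partition b" "is_partition g" "minimal_in a b g (klein_ref a b g T) P"
  shows "\<not> arc_move (arc_diagram b g P) D"
proof
  obtain A' Q' where D: "D = (A', Q')" by (cases D)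
  assume "arc_move (arc_diagram b g P) D"
  then have "arc_move (arcs b g P, poles b g P) (A', Q')" by (simp add: arc_diagram_def D)
  then show False
  proof (cases rule: arc_move_cases)
    case (crossing m n r s A0)
    then show False using minimal_no_crossing[OF assms, of m r n s] by simp
  next
    case (covered_pole m r s A0 Q0)
    then show False using minimal_no_covered_pole[OF assms, of m s r] by simp
  qed
qed

lemma minimal_refining_minimal:
  assumes "is_partition b" "is_partition g" "minimal_in a b g (klein_ref a b g T) P"
  shows "minimal_in a b g (klein_all a b g) P"
proof -
  have P: "klein a b g P" using assms(3) by (simp add: minimal_in_def klein_ref_def)
  have "P' = P" if "arc_le a b g P' P" for P'
  proof -
    have "arc_diagram b g P = arc_diagram b g P'"
      using that minimal_refining_no_move[OF assms] by (auto simp: arc_le_def elim: converse_rtranclpE)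
    then show ?thesis
      using that arc_diagram_eqI[OF assms(1,2)] by (auto simp: arc_le_def)
  qed
  then show ?thesis using P by (auto simp: minimal_in_def klein_all_def)
qed

lemma maximal_refining_unique:
  assumes "is_partition b" "is_partition g"
    and "maximal_in a b g (klein_ref a b g T) P" "maximal_in a b g (klein_ref a b g T) P'"
  shows "P = P'"
proof (rule ccontr)
  assume neq: "P \<noteq> P'"
  have no_move: False
    if R: "maximal_in a b g (klein_ref a b g T) R"
      "valid (row_size b g) (overlap b g) (conj a 2) A Q"
      "arc_move (A, Q) (arcs b g R, poles b g R)" "image_mset fst A = image_mset fst (arcs b g R)"
    for R A Q
  proof -
    have K: "klein a b g R" "forget R = T" using R(1) by (auto simp: maximal_in_def klein_ref_def)
    obtain R' where R': "klein a b g R'" "arc_diagram b g R' = (A, Q)" "R' \<noteq> R"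
      using realise_valid[OF assms(1,2) K(1) R(2)] R(3) unfolding arc_diagram_def by blast
    have "forget R' = T"
      using forget_eq_iff[OF assms(1,2) R'(1) K(1)] K(2) R'(2) R(4) by (simp add: arc_diagram_def)
    moreover have "arc_le a b g R R'"
      using K(1) R' R(3) by (simp add: arc_le_def r_into_rtranclp arc_diagram_def)
    ultimately show False using R(1) R' by (auto simp: maximal_in_def klein_ref_def)
  qed
  have K: "klein a b g P" "klein a b g P'" "forget P = forget P'"
    using assms(3,4) by (auto simp: maximal_in_def klein_ref_def)
  have "arcs b g P \<noteq> arcs b g P'" using neq klein_eqI[OF assms(1,2) K(1,2)] by blast
  moreover have "image_mset fst (arcs b g P) = image_mset fst (arcs b g P')"
    using forget_eq_iff[OF assms(1,2) K(1,2)] K(3) by simp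
  ultimately show False
    using same_starts_move_up_either[OF klein_valid[OF K(1)] klein_valid[OF K(2)]]
      no_move[OF assms(3)] no_move[OF assms(4)] by blast
qed

lemma maximal_unique:
  assumes "is_partition b" "is_partition g"
    and "maximal_in a b g (klein_all a b g) P" "maximal_in a b g (klein_all a b g) P'"
  shows "P = P'"
proof -
  have no_move: False
    if R: "maximal_in a b g (klein_all a b g) R"
      "valid (row_size b g) (overlap b g) (conj a 2) A Q"
      "arc_move (A, Q) (arcs b g R, poles b g R)"
    for R A Q
  proof -
    have K: "klein a b g R" using R(1) by (auto simp: maximal_in_def klein_all_def)
    obtain R' where R': "klein a b g R'" "arc_diagram b g R' = (A, Q)" "R' \<noteq> R"
      using realise_valid[OF assms(1,2) K(1) R(2)] R(3) unfolding arc_diagram_def by blast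
    have "arc_le a b g R R'"
      using K(1) R' R(3) by (simp add: arc_le_def r_into_rtranclp arc_diagram_def)
    then show False using R(1) R' by (auto simp: maximal_in_def klein_all_def)
  qed
  have K: "klein a b g P" "klein a b g P'"
    using assms(3,4) by (auto simp: maximal_in_def klein_all_def)
  have "image_mset fst (arcs b g P) = image_mset fst (arcs b g P')"
    using diff_starts_move_up_either[OF klein_valid[OF K(1)] klein_valid[OF K(2)]]
      no_move[OF assms(3)] no_move[OF assms(4)] by blast
  then have "forget P = forget P'"
    using forget_eq_iff[OF assms(1,2) K] by simp
  \<comment> \<open>Both tableaux now refine the same LR-tableau, and maximality among all Klein
    tableaux passes to this subset.\<close>
  then show ?thesis
    using assms(3,4) by (intro maximal_refining_unique[OF assms(1,2), of a "forget P"])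
      (auto simp: maximal_in_def klein_all_def klein_ref_def)
qed

section \<open>The greedy filling\<close>

text \<open>Scanning order of the greedy choice. Within a row it runs from right to left, because
  subscripts weakly increase along a row and the largest ones belong to the last boxes.\<close>

definition box_before :: "nat \<times> nat \<Rightarrow> nat \<times> nat \<Rightarrow> bool" where
  "box_before x y \<longleftrightarrow> fst x < fst y \<or> fst x = fst y \<and> snd y < snd x"

lemma sorted_dom_boxes: "sorted_wrt box_before (dom_boxes b g T)"
proof -
  have "sorted_wrt box_before (concat (map (\<lambda>i. map (\<lambda>j. (i, j)) js) is))"
    if "sorted_wrt (<) is" "sorted_wrt (>) js" for "is" js :: "nat list"
    using that by (induction "is") (auto simp: sorted_wrt_append sorted_wrt_map box_before_def)
  then show ?thesis
    unfolding dom_boxes_def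
    by (intro sorted_wrt_filter) (simp add: sorted_wrt_rev del: upt_Suc)
qed

lemma set_dom_boxes:
  assumes "is_partition b"
  shows "set (dom_boxes b g T) = {(i, j). (i, j) \<in> skew b g \<and> T i j = 2}"
proof -
  have "1 \<le> i \<and> i \<le> col b 1 \<and> 1 \<le> j \<and> j \<le> length b" if s: "(i, j) \<in> skew b g" for i j
  proof -
    have "i \<le> col b j" using s by (simp add: skew_def)
    then show ?thesis
      using skew_bounds[OF s] le_col_iff[OF assms, of i j] le_col_iff[OF assms, of i 1] by simp
  qed
  then show ?thesis
    unfolding dom_boxes_def by (fastforce simp del: upt_Suc)
qed

text \<open>Where the greedy choice exceeds the subscript in \<open>P\<close>, the larger subscript sits in \<open>P\<close> on a
  pole covered by the arc or on an arc crossing it.\<close>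

lemma greedy_step:
  assumes "is_partition b" "is_partition g" "minimal_in a b g (klein_ref a b g T) P"
    and xs: "dom_boxes b g T = ys @ (i, j) # zs"
    and cnt: "\<And>r. cnt r = card {x \<in> set ys. P (fst x) (snd x) = K2 r}"
  shows "P i j = K2 (subscr (P i j))"
    and "dom_step b g T (i, j) (sg, cnt) = (sg((i, j) := subscr (P i j)), cnt(subscr (P i j) := Suc (cnt (subscr (P i j)))))"
proof -
  have P: "klein a b g P" "forget P = T" using assms(3) by (auto simp: minimal_in_def klein_ref_def)
  have set: "set ys \<union> {(i, j)} \<union> set zs = {(i, j). (i, j) \<in> skew b g \<and> T i j = 2}"
    using set_dom_boxes[OF assms(1), of g T] unfolding xs by auto
  have sorted: "sorted_wrt box_before (ys @ (i, j) # zs)"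
    using sorted_dom_boxes[of b g T] unfolding xs .
  have x: "(i, j) \<in> skew b g" "T i j = 2" using set by auto
  then have "forget P i j = 2" using P(2) by simp
  then obtain r0 where r0: "P i j = K2 r0" by auto
  then have sub: "subscr (P i j) = r0" by (simp add: subscr_def)
  then show "P i j = K2 (subscr (P i j))" using r0 by simp
  have "0 < count (arcs b g P) (i, r0)"
    unfolding count_arcs_eq_card by (subst card_gt_0_iff) (use x r0 in auto)
  then have arc: "(i, r0) \<in># arcs b g P" by simp
  have ys: "{x \<in> set ys. P (fst x) (snd x) = K2 r} \<subseteq> {(i, j). (i, j) \<in> skew b g \<and> P i j = K2 r}" for r
    using set by auto
  have "(i, j) \<notin> set ys"
    using sorted by (auto simp: sorted_wrt_append box_before_def)
  \<comment> \<open>The box at hand carries \<open>r0\<close> and has not been scanned, so the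
    scanned boxes cannot exhaust this subscript.\<close>
  then have "cnt r0 < count (image_mset snd (arcs b g P)) r0"
    unfolding cnt count_snd_eq_card using ys[of r0] x r0 by (intro psubset_card_mono) auto
  also have "\<dots> \<le> ones_in_row b g T r0" using klein_count_le[OF P(1), of r0] P(2) by simp
  finally have cnt_r0: "cnt r0 < ones_in_row b g T r0" .
  have one: "P (i - 1) j = K1" if "T (i - 1) j = 1"
    using that P(2) by auto
  have avail: "dom_avail b g T cnt i j r0"
    using cnt_r0 klein_subscript_bounds[OF P(1) r0] klein_below_one[OF P(1) r0] one
    by (auto simp: dom_avail_def)
  have le: "r \<le> r0" if r: "dom_avail b g T cnt i j r" for r
  proof (rule ccontr)
    assume "\<not> r \<le> r0"
    then have less: "r0 < r" "r < i" using r klein_subscript_bounds[OF P(1) r0] by (auto simp: dom_avail_def)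
    show False
    proof (cases "count (image_mset snd (arcs b g P)) r < ones_in_row b g T r")
      case True
      then have "0 < count (poles b g P) r" by (simp add: count_poles P(2))
      then show False
        using minimal_no_covered_pole[OF assms(1-3) arc _ less] by simp
    next
      case False
      \<comment> \<open>\<open>P\<close> uses every 1 of row \<open>r\<close>, whereas the greedy
        choice still has one left; so \<open>P\<close> places some subscript \<open>r\<close> on a
        box not yet scanned.\<close>
      then have "cnt r < count (image_mset snd (arcs b g P)) r"
        using r by (auto simp: dom_avail_def)
      then have "{(i, j). (i, j) \<in> skew b g \<and> P i j = K2 r} \<noteq> {x \<in> set ys. P (fst x) (snd x) = K2 r}"
        unfolding cnt count_snd_eq_card by auto
      then obtain i' j' where y: "(i', j') \<in> skew b g" "P i' j' = K2 r" "(i', j') \<notin> set ys"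
        using ys[of r] by force
      then have "forget P i' j' = 2" by simp
      then have "(i', j') \<in> set ys \<union> {(i, j)} \<union> set zs"
        unfolding set using y(1) P(2) by simp
      then have "(i', j') \<in> set zs" using y less r0 by auto
      then have "i < i' \<or> i = i' \<and> j' < j"
        using sorted by (auto simp: sorted_wrt_append box_before_def)
      then show False
      proof
        \<comment> \<open>The arcs \<open>(i', r)\<close> and \<open>(i, r0)\<close> cross, since
          \<open>r0 < r < i < i'\<close>.\<close>
        assume "i < i'"
        have "0 < count (arcs b g P) (i', r)"
          unfolding count_arcs_eq_card by (subst card_gt_0_iff) (use y in auto)
        then have "(i', r) \<in># arcs b g P" by simp
        then show False using minimal_no_crossing[OF assms(1-3) _ arc less \<open>i < i'\<close>] by simp
      next
        assume "i = i' \<and> j' < j"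
        then show False using klein_row_mono[OF P(1) _ r0, of j' r] y(2) less by simp
      qed
    qed
  qed
  have "finite {r. dom_avail b g T cnt i j r}"
    by (rule finite_subset[of _ "{..i}"]) (auto simp: dom_avail_def)
  then have "Max {r. dom_avail b g T cnt i j r} = r0"
    using le avail by (intro Max_eqI) auto
  then show "dom_step b g T (i, j) (sg, cnt) = (sg((i, j) := subscr (P i j)), cnt(subscr (P i j) := Suc (cnt (subscr (P i j)))))"
    using avail by (auto simp: dom_step_def sub)
qed

text \<open>Invariant over scanned prefixes, hence an induction that appends at the end. Keeping the
  counters equal to the subscript counts of \<open>P\<close> is what allows the next greedy step to
  be compared with \<open>P\<close>.\<close>

lemma greedy_fold:
  assumes "is_partition b" "is_partition g" "minimal_in a b g (klein_ref a b g T) P"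
    and "dom_boxes b g T = ys @ zs"
  shows "\<exists>sg cnt. fold (dom_step b g T) ys (\<lambda>_. 0, \<lambda>_. 0) = (sg, cnt) \<and>
    (\<forall>x\<in>set ys. P (fst x) (snd x) = K2 (sg x)) \<and>
    (\<forall>r. cnt r = card {x \<in> set ys. P (fst x) (snd x) = K2 r})"
  using assms(4)
proof (induction ys arbitrary: zs rule: rev_induct)
  case (snoc x ys)
  obtain i j where x: "x = (i, j)" by (cases x)
  obtain sg cnt where IH: "fold (dom_step b g T) ys (\<lambda>_. 0, \<lambda>_. 0) = (sg, cnt)"
    "\<forall>x\<in>set ys. P (fst x) (snd x) = K2 (sg x)" "\<And>r. cnt r = card {x \<in> set ys. P (fst x) (snd x) = K2 r}"
    using snoc.IH[of "x # zs"] snoc.prems by auto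
  let ?r = "subscr (P i j)"
  have xs: "dom_boxes b g T = ys @ (i, j) # zs" using snoc.prems x by simp
  note step = greedy_step[OF assms(1-3) xs IH(3)]
  have "sorted_wrt box_before (ys @ (i, j) # zs)"
    using sorted_dom_boxes[of b g T] unfolding xs .
  then have new: "(i, j) \<notin> set ys"
    by (auto simp: sorted_wrt_append box_before_def)
  have "card {y \<in> set (ys @ [x]). P (fst y) (snd y) = K2 r} = (cnt(?r := Suc (cnt ?r))) r" for r
  proof (cases "r = ?r")
    case True
    then have "{y \<in> set (ys @ [x]). P (fst y) (snd y) = K2 r} = insert (i, j) {y \<in> set ys. P (fst y) (snd y) = K2 r}"
      using step(1) x by auto
    then show ?thesis using True new IH(3) by simp
  next
    case False
    then have "{y \<in> set (ys @ [x]). P (fst y) (snd y) = K2 r} = {y \<in> set ys. P (fst y) (snd y) = K2 r}"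
      using x by (auto simp: subscr_def)
    then show ?thesis using False IH(3) by simp
  qed
  moreover have "fold (dom_step b g T) (ys @ [x]) (\<lambda>_. 0, \<lambda>_. 0) = (sg(x := ?r), cnt(?r := Suc (cnt ?r)))"
    using step(2) IH(1) x by simp
  moreover have "\<forall>y\<in>set (ys @ [x]). P (fst y) (snd y) = K2 ((sg(x := ?r)) y)"
    using IH(2) step(1) x new by auto
  ultimately show ?case by auto
qed simp

text \<open>Gives uniqueness and the explicit form at once. As minimal elements exist by the
  potential, that the greedy choice never gets stuck and yields a Klein tableau is a consequence,
  not something to be shown beforehand.\<close>

lemma minimal_eq_dominant:
  assumes "is_partition b" "is_partition g" "minimal_in a b g (klein_ref a b g T) P"
  shows "P = dominant b g T"
proof (intro ext)
  fix i j
  have P: "klein a b g P" "forget P = T" using assms(3) by (auto simp: minimal_in_def klein_ref_def)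
  obtain sg cnt where fold: "fold (dom_step b g T) (dom_boxes b g T) (\<lambda>_. 0, \<lambda>_. 0) = (sg, cnt)"
    "\<forall>x\<in>set (dom_boxes b g T). P (fst x) (snd x) = K2 (sg x)"
    using greedy_fold[OF assms, of "dom_boxes b g T" "[]"] by auto
  show "P i j = dominant b g T i j"
  proof (cases "(i, j) \<in> skew b g")
    case False
    then show ?thesis using klein_in_skew[OF P(1), of i j] by (auto simp: dominant_def fold(1))
  next
    case True
    have "T i j = 1 \<or> T i j = 2"
      using lr_tableau_values[OF klein_lr_tableau[OF P(1)] True] P(2) by simp
    then show ?thesis
    proof
      assume "T i j = 1"
      then have "P i j = K1" using P(2) by auto
      then show ?thesis using True \<open>T i j = 1\<close> by (simp add: dominant_def)
    next
      assume T: "T i j = 2"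
      then have "(i, j) \<in> set (dom_boxes b g T)" using True set_dom_boxes[OF assms(1)] by simp
      then have "P i j = K2 (sg (i, j))" using fold(2) by fastforce
      then show ?thesis using True T by (simp add: dominant_def fold(1))
    qed
  qed
qed

theorem theorem5p6:
  fixes a b g :: "nat list"
  assumes "is_partition a" and "is_partition b" and "is_partition g"
    and "col a 1 \<le> 2"
    and "part_le g b"
  shows
    "(\<forall>T. lr_tableau a b g T \<longrightarrow>
        {P. minimal_in a b g (klein_ref a b g T) P} = {dominant b g T}
      \<and> (\<exists>!P. maximal_in a b g (klein_ref a b g T) P))
   \<and> ((\<exists>T. lr_tableau a b g T) \<longrightarrow> (\<exists>!P. maximal_in a b g (klein_all a b g) P))
   \<and> {P. minimal_in a b g (klein_all a b g) P}
       = (\<Union>T\<in>{T. lr_tableau a b g T}. {P. minimal_in a b g (klein_ref a b g T) P})"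
proof (intro conjI allI impI)
  fix T assume "lr_tableau a b g T"
  then obtain P0 where P0: "P0 \<in> klein_ref a b g T"
    using lr_tableau_refined[OF assms(2,3)] by (auto simp: klein_ref_def)
  obtain P where "minimal_in a b g (klein_ref a b g T) P"
    using exists_minimal[OF assms(2,3) P0] by blast
  then show "{P. minimal_in a b g (klein_ref a b g T) P} = {dominant b g T}"
    using minimal_eq_dominant[OF assms(2,3)] by blast
  have "\<exists>P. maximal_in a b g (klein_ref a b g T) P"
    by (rule exists_maximal[OF assms(2,3) P0]) (simp add: klein_ref_def)
  then show "\<exists>!P. maximal_in a b g (klein_ref a b g T) P"
    using maximal_refining_unique[OF assms(2,3)] by blast
next
  \<comment> \<open>A type without LR-tableaux has no Klein tableaux, so a maximal element can exist
    only under this assumption.\<close>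
  assume "\<exists>T. lr_tableau a b g T"
  then obtain P0 where P0: "P0 \<in> klein_all a b g"
    using lr_tableau_refined[OF assms(2,3)] by (auto simp: klein_all_def)
  have "\<exists>P. maximal_in a b g (klein_all a b g) P"
    by (rule exists_maximal[OF assms(2,3) P0]) (simp add: klein_all_def)
  then show "\<exists>!P. maximal_in a b g (klein_all a b g) P"
    using maximal_unique[OF assms(2,3)] by blast
next
  show "{P. minimal_in a b g (klein_all a b g) P}
       = (\<Union>T\<in>{T. lr_tableau a b g T}. {P. minimal_in a b g (klein_ref a b g T) P})" (is "?L = ?R")
  proof
    show "?L \<subseteq> ?R"
    proof
      fix P assume "P \<in> ?L"
      \<comment> \<open>Minimality passes to the subset of tableaux refining
        \<open>forget P\<close>; the opposite inclusion is where the absence of all moves is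
        used.\<close>
      then have "lr_tableau a b g (forget P)" "minimal_in a b g (klein_ref a b g (forget P)) P"
        using klein_lr_tableau by (auto simp: minimal_in_def klein_all_def klein_ref_def)
      then show "P \<in> ?R" by blast
    qed
    show "?R \<subseteq> ?L" using minimal_refining_minimal[OF assms(2,3)] by blast
  qed
qed

end
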